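(* Let $(E_i,\alpha_i)$, $i=1,\dots,n$, be Polish measure spaces with regular $\sigma$-finite Borel measures $\alpha_i$, and let $m_1,\dots,m_n\in(0,\infty]$. For any function $$\Phi:\prod_{i=1}^n\mathcal{P}_{m_i}(E_i)\to\mathbb{R}$$ that is coordinate-convex and lower semi-continuous (with respect to the product of the weak-* topologies), we have $$\sup_{(\mu_1,\dots,\mu_n)\in\prod_{i=1}^n\mathcal{P}_{m_i}(E_i)}\Phi(\mu_1,\dots,\mu_n)=\sup_{(\mu_1,\dots,\mu_n)\in\prod_{i=1}^n\mathcal{P}^*_{m_i}(E_i)}\Phi(\mu_1,\dots,\mu_n).$$
   Context: Let $E$ be a Polish space with its Borel $\sigma$-algebra and a regular $\sigma$-finite Borel measure $\alpha$ (regular: Borel sets can be approximated in measure by compact sets from within and by open sets from outside). $\mathcal{P}(E)$ is the set of Borel probability measures on $E$ with the weak-* topology, i.e. the topology of weak convergence (convergence of integrals of bounded continuous functions). For $\mu\in\mathcal{P}(E)$, $M(\mu)=\sup\{\mu(A)/\alpha(A):\alpha(A)>0\}\in[0,\infty]$, and $\mathcal{P}_m(E)=\{\mu\in\mathcal{P}(E): M(\mu)\le m\}$. "Coordinate-convex" means convex in each coordinate when the other coordinates are held fixed. $\mathcal{P}^*_m(E)$ is defined as follows. If $m=\infty$, it is the set of Dirac measures on $E$. If $m<\infty$ and $m\,\alpha(E)>1$, it is the set of probability measures $\mu$ having a density of the form $$\frac{d\mu}{d\alpha}(y)=m\,\mathbf{1}_U(y)+c\,\mathbf{1}_{\{x\}}(y)$$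 for some measurable $U$ contained in a compact subset of $E$, some $c\in[0,m)$ and some $x\notin U$. If $m<\infty$ and $m\,\alpha(E)\le 1$, then $\mathcal{P}^*_m(E)=\mathcal{P}_m(E)$ (which is at most a singleton).
   Formalization: For finite m, P_m(E) is taken to consist of the measures with M(μ) ≤ m that are also absolutely continuous with respect to α; otherwise the claim fails, e.g. E={0,1}, α=δ_0, m=2, Φ(μ)=μ({1}) gives 1 on one side and 0 on the other. *)

theory Defs
  imports "HOL-Analysis.Analysis" "HOL-Probability.Probability"
begin

text \<open>
  Polish spaces are abstract topologies rather than instances of the type class
  \<^class>\<open>polish_space\<close>, so that a finite family of different spaces has a single type.
\<close>

definition polish_topology :: "'a topology \<Rightarrow> bool" where
  "polish_topology X \<longleftrightarrow> completely_metrizable_space X \<and> separable_space X"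

definition borel_of :: "'a topology \<Rightarrow> 'a measure" where
  "borel_of X = sigma (topspace X) {U. openin X U}"

definition regular_measure :: "'a topology \<Rightarrow> 'a measure \<Rightarrow> bool" where
  "regular_measure X \<alpha> \<longleftrightarrow>
     (\<forall>A\<in>sets \<alpha>.
        emeasure \<alpha> A = (SUP K\<in>{K. compactin X K \<and> K \<subseteq> A}. emeasure \<alpha> K) \<and>
        emeasure \<alpha> A = (INF U\<in>{U. openin X U \<and> A \<subseteq> U}. emeasure \<alpha> U))"

definition polish_measure_space :: "'a topology \<Rightarrow> 'a measure \<Rightarrow> bool" where
  "polish_measure_space X \<alpha> \<longleftrightarrow>
     polish_topology X \<and> sets \<alpha> = sets (borel_of X) \<and>
     sigma_finite_measure \<alpha> \<and> regular_measure X \<alpha>"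

definition borel_probs :: "'a topology \<Rightarrow> 'a measure set" where
  "borel_probs X = {\<mu>. sets \<mu> = sets (borel_of X) \<and> prob_space \<mu>}"

text \<open>The coarsest topology on the Borel probability measures for which integration
  against every bounded continuous real function is continuous.\<close>

definition weak_topology :: "'a topology \<Rightarrow> 'a measure topology" where
  "weak_topology X = topology_generated_by
     {{\<mu> \<in> borel_probs X. (\<integral>x. f x \<partial>\<mu>) \<in> V} | f V.
        continuous_map X euclideanreal f \<and> bounded (f ` topspace X) \<and> open V}"

definition max_density :: "'a measure \<Rightarrow> 'a measure \<Rightarrow> ennreal" where
  "max_density \<alpha> \<mu> =
     (SUP A\<in>{A \<in> sets \<alpha>. emeasure \<alpha> A > 0}. emeasure \<mu> A / emeasure \<alpha> A)"

text \<open>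
  The supremum in \<^const>\<open>max_density\<close> does not see sets of \<open>\<alpha>\<close>-measure zero. A finite density
  bound is understood to include that \<open>\<mu>\<close> has a density, that is, that \<open>\<alpha>\<close>-null sets are
  \<open>\<mu>\<close>-null. This is automatic if \<open>\<alpha>\<close> is outer regular and charges every nonempty open set.
  It is not automatic in general: for \<open>\<alpha>\<close> a point mass at 0 on the space \<open>{0, 1}\<close>,
  the point mass at 1 has \<open>max_density\<close> equal to 1.
\<close>

definition bounded_probs :: "'a topology \<Rightarrow> 'a measure \<Rightarrow> ennreal \<Rightarrow> 'a measure set" where
  "bounded_probs X \<alpha> m =
     {\<mu> \<in> borel_probs X. max_density \<alpha> \<mu> \<le> m \<and> (m < \<infinity> \<longrightarrow> absolutely_continuous \<alpha> \<mu>)}"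

definition extremal_probs :: "'a topology \<Rightarrow> 'a measure \<Rightarrow> ennreal \<Rightarrow> 'a measure set" where
  "extremal_probs X \<alpha> m =
     (if m = \<infinity> then {return (borel_of X) x | x. x \<in> topspace X}
      else if m * emeasure \<alpha> (topspace X) > 1 then
        {\<mu> \<in> borel_probs X. \<exists>U c x K.
           U \<in> sets \<alpha> \<and> compactin X K \<and> U \<subseteq> K \<and> c < m \<and> x \<in> topspace X - U \<and>
           \<mu> = density \<alpha> (\<lambda>y. m * indicator U y + c * indicator {x} y)}
      else bounded_probs X \<alpha> m)"

text \<open>The measure \<open>(1 - t) \<mu> + t \<nu>\<close>, for measures on the same \<open>\<sigma>\<close>-algebra.\<close>

definition mixture :: "real \<Rightarrow> 'a measure \<Rightarrow> 'a measure \<Rightarrow> 'a measure" where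
  "mixture t \<mu> \<nu> = measure_of (space \<mu>) (sets \<mu>)
     (\<lambda>A. ennreal (1 - t) * emeasure \<mu> A + ennreal t * emeasure \<nu> A)"

definition coordinate_convex ::
    "'i set \<Rightarrow> ('i \<Rightarrow> 'a measure set) \<Rightarrow> (('i \<Rightarrow> 'a measure) \<Rightarrow> real) \<Rightarrow> bool" where
  "coordinate_convex I S \<Phi> \<longleftrightarrow>
     (\<forall>\<mu>\<in>\<Pi>\<^sub>E i\<in>I. S i. \<forall>i\<in>I. \<forall>\<nu>\<^sub>0\<in>S i. \<forall>\<nu>\<^sub>1\<in>S i. \<forall>t\<in>{0..1}.
        \<Phi> (\<mu>(i := mixture t \<nu>\<^sub>0 \<nu>\<^sub>1)) \<le> (1 - t) * \<Phi> (\<mu>(i := \<nu>\<^sub>0)) + t * \<Phi> (\<mu>(i := \<nu>\<^sub>1)))"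

definition lower_semicontinuous_map :: "'b topology \<Rightarrow> ('b \<Rightarrow> real) \<Rightarrow> bool" where
  "lower_semicontinuous_map T f \<longleftrightarrow> (\<forall>a. openin T {x \<in> topspace T. a < f x})"

lemma space_eq_topspace:
  assumes "sets \<mu> = sets (borel_of X)" shows "space \<mu> = topspace X"
  using sets_eq_imp_space_eq[OF assms] unfolding borel_of_def by (simp add: space_measure_of_conv)

lemma topspace_weak_topology: "topspace (weak_topology X) = borel_probs X"
proof -
  have "{\<mu> \<in> borel_probs X. (\<integral>x. 0 \<partial>\<mu>) \<in> (UNIV::real set)} \<in>
     {{\<mu> \<in> borel_probs X. (\<integral>x. f x \<partial>\<mu>) \<in> V} | f V.
        continuous_map X euclideanreal f \<and> bounded (f ` topspace X) \<and> open V}"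
    by (intro CollectI exI[of _ "\<lambda>_. 0"] exI[of _ UNIV]) (auto intro: finite_imp_bounded finite_subset[of _ "{0}"])
  then show ?thesis
    unfolding weak_topology_def by (auto simp: topology_generated_by_topspace)
qed

lemma sets_mixture [simp]: "sets (mixture t \<mu> \<nu>) = sets \<mu>"
  and space_mixture [simp]: "space (mixture t \<mu> \<nu>) = space \<mu>"
  unfolding mixture_def by auto

lemma emeasure_mixture:
  assumes "sets \<nu> = sets \<mu>" and A: "A \<in> sets \<mu>"
  shows "emeasure (mixture t \<mu> \<nu>) A = ennreal (1 - t) * emeasure \<mu> A + ennreal t * emeasure \<nu> A"
  unfolding mixture_def
proof (rule emeasure_measure_of_sigma[OF sets.sigma_algebra_axioms _ _ A])
  show "countably_additive (sets \<mu>)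
          (\<lambda>A. ennreal (1 - t) * emeasure \<mu> A + ennreal t * emeasure \<nu> A)"
    unfolding countably_additive_def
    by (auto simp: suminf_add[symmetric] assms(1) suminf_emeasure)
qed (auto simp: positive_def)

lemma mixture_bounded_probs:
  assumes \<alpha>: "sets \<alpha> = sets (borel_of X)"
    and \<mu>: "\<mu> \<in> bounded_probs X \<alpha> m" and \<nu>: "\<nu> \<in> bounded_probs X \<alpha> m" and t: "t \<in> {0..1}"
  shows "mixture t \<mu> \<nu> \<in> bounded_probs X \<alpha> m"
proof -
  note d = bounded_probs_def borel_probs_def
  have s: "sets \<mu> = sets \<alpha>" "sets \<nu> = sets \<alpha>" using assms by (auto simp: d)
  have s': "sets \<nu> = sets \<mu>" using s by simp
  have sp: "space \<nu> = space \<mu>" using s' by (rule sets_eq_imp_space_eq)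
  have t1: "ennreal (1 - t) + ennreal t = 1" using t by (simp add: ennreal_plus[symmetric])
  have e: "emeasure (mixture t \<mu> \<nu>) A = ennreal (1 - t) * emeasure \<mu> A + ennreal t * emeasure \<nu> A"
    if "A \<in> sets \<alpha>" for A using emeasure_mixture[OF s'] that s by simp
  have "emeasure \<mu> (space \<mu>) = 1" "emeasure \<nu> (space \<nu>) = 1"
    using \<mu> \<nu> by (auto simp: d prob_space.emeasure_space_1)
  then have p: "prob_space (mixture t \<mu> \<nu>)"
    using t1 sp by (intro prob_spaceI) (simp add: emeasure_mixture[OF s'])
  have "max_density \<alpha> (mixture t \<mu> \<nu>) \<le> m"
    unfolding max_density_def
  proof (rule SUP_least, clarify)
    fix A assume A: "A \<in> sets \<alpha>" "emeasure \<alpha> A > 0"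
    have 1: "emeasure \<mu> A / emeasure \<alpha> A \<le> m" "emeasure \<nu> A / emeasure \<alpha> A \<le> m"
      using \<mu> \<nu> A unfolding d max_density_def by (auto simp: SUP_le_iff)
    have "emeasure (mixture t \<mu> \<nu>) A / emeasure \<alpha> A
        = ennreal (1 - t) * (emeasure \<mu> A / emeasure \<alpha> A) + ennreal t * (emeasure \<nu> A / emeasure \<alpha> A)"
      by (simp add: e[OF A(1)] divide_ennreal_def distrib_right mult.assoc)
    also have "\<dots> \<le> ennreal (1 - t) * m + ennreal t * m"
      using 1 by (intro add_mono mult_left_mono) auto
    also have "\<dots> = m" by (simp add: distrib_right[symmetric] t1)
    finally show "emeasure (mixture t \<mu> \<nu>) A / emeasure \<alpha> A \<le> m" .
  qed
  moreover have "absolutely_continuous \<alpha> (mixture t \<mu> \<nu>)" if "m < \<infinity>"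
    using \<mu> \<nu> that s unfolding d absolutely_continuous_def
    by (auto simp: null_sets_def e subset_iff)
  ultimately show ?thesis using p s \<alpha> by (auto simp: d)
qed

lemma extremal_probs_subset:
  assumes X: "polish_topology X" and \<alpha>: "sets \<alpha> = sets (borel_of X)"
  shows "extremal_probs X \<alpha> m \<subseteq> bounded_probs X \<alpha> m"
proof
  note d = bounded_probs_def borel_probs_def
  fix \<mu> assume \<mu>: "\<mu> \<in> extremal_probs X \<alpha> m"
  have sp: "space (borel_of X) = topspace X" by (rule space_eq_topspace) simp
  consider "m = \<infinity>" | "m \<noteq> \<infinity>" "m * emeasure \<alpha> (topspace X) > 1" | "m \<noteq> \<infinity>" "\<not> m * emeasure \<alpha> (topspace X) > 1"
    by blast
  then show "\<mu> \<in> bounded_probs X \<alpha> m"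
  proof cases
    case 1
    then show ?thesis using \<mu> sp by (auto simp: extremal_probs_def d intro: prob_space_return)
  next
    case 2
    then obtain U c x where b: "\<mu> \<in> borel_probs X" and U: "U \<in> sets \<alpha>" and c: "c < m"
      and x: "x \<in> topspace X - U"
      and eq: "\<mu> = density \<alpha> (\<lambda>y. m * indicator U y + c * indicator {x} y)"
      using \<mu> by (auto simp: extremal_probs_def)
    have "Hausdorff_space X"
      using X by (auto simp: polish_topology_def completely_metrizable_imp_metrizable_space
          metrizable_imp_Hausdorff_space)
    then have "closedin X {x}" using x by (simp add: closedin_Hausdorff_singleton)
    then have "topspace X - {x} \<in> sigma_sets (topspace X) {U. openin X U}"
      by (intro sigma_sets.Basic) (simp add: closedin_def)
    then have "topspace X - (topspace X - {x}) \<in> sets (borel_of X)"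
      unfolding borel_of_def
      by (subst sets_measure_of) (auto simp only: Pow_iff mem_Collect_eq dest: openin_subset intro: sigma_sets.Compl)
    then have xs: "{x} \<in> sets \<alpha>" using x \<alpha> by (simp add: double_diff)
    let ?f = "\<lambda>y. m * indicator U y + c * indicator {x} y"
    have f: "?f \<in> borel_measurable \<alpha>" using U xs by measurable
    have le: "?f y \<le> m" for y using x c by (auto simp: indicator_def)
    have bd: "emeasure \<mu> A \<le> m * emeasure \<alpha> A" if A: "A \<in> sets \<alpha>" for A
    proof -
      have "emeasure \<mu> A = (\<integral>\<^sup>+y. ?f y * indicator A y \<partial>\<alpha>)"
        unfolding eq by (rule emeasure_density[OF f A])
      also have "\<dots> \<le> (\<integral>\<^sup>+y. m * indicator A y \<partial>\<alpha>)"
        by (intro nn_integral_mono mult_right_mono le) auto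
      finally show ?thesis using A by (simp add: nn_integral_cmult_indicator)
    qed
    have "max_density \<alpha> \<mu> \<le> m"
      unfolding max_density_def
    proof (rule SUP_least, clarify)
      fix A assume A: "A \<in> sets \<alpha>" "emeasure \<alpha> A > 0"
      show "emeasure \<mu> A / emeasure \<alpha> A \<le> m"
      proof (cases "emeasure \<alpha> A = \<infinity>")
        case True then show ?thesis by (simp add: divide_ennreal_def)
      next
        case False then show ?thesis
          using bd[OF A(1)] A(2) by (simp add: divide_le_posI_ennreal mult.commute)
      qed
    qed
    moreover have "absolutely_continuous \<alpha> \<mu>"
      unfolding eq by (rule absolutely_continuousI_density[OF f])
    ultimately show ?thesis using b by (auto simp: bounded_probs_def)
  next
    case 3
    then show ?thesis using \<mu> by (simp add: extremal_probs_def)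
  qed
qed

end

theory Submission
  imports Defs
begin

text \<open>
  The product only enters through one coordinate at a time: if \<open>\<Phi>\<close> exceeds a level \<open>a\<close> somewhere on
  the product, it is enough to move the coordinates one after the other to extremal measures while
  keeping \<open>\<Phi> > a\<close>. So let \<open>\<phi>\<close> be convex and lower semicontinuous on the probability measures with
  density at most \<open>m\<close> on a single space, with \<open>\<phi> \<mu> > a\<close>. A convex function that is at most \<open>a\<close> on the
  extremal measures is at most \<open>a\<close> on their convex hull, and the set where \<open>\<phi> > a\<close> is weakly open.
  Everything therefore reduces to one density statement, \<open>extremal_hull_weakly_dense\<close>: finite convex
  combinations of extremal measures are weakly dense.

  A basic weak neighbourhood of \<open>\<mu>\<close> tests finitely many bounded continuous functions. These are nearly
  constant on the cells of a finite Borel partition, so a measure lies in the neighbourhood as soon as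
  its masses on the cells are close to those of \<open>\<mu>\<close>. Only a vector of finitely many cell masses has to
  be matched.

  For \<open>m = \<infinity>\<close> that vector lies in a simplex, whose vertices are realised by Dirac measures. For
  \<open>m < \<infinity>\<close> and \<open>m * \<alpha> E \<le> 1\<close> every admissible measure is extremal by definition. For \<open>m < \<infinity>\<close> and
  \<open>m * \<alpha> E > 1\<close>, the masses of \<open>\<mu>\<close> are first moved slightly towards the uniform distribution on a
  compact set \<open>K\<close> with \<open>m * \<alpha> K > 1\<close>. After that the mass of each cell \<open>B\<close> is zero or strictly below
  \<open>m * \<alpha> B\<close>, and hence at most \<open>m * \<alpha> (C B)\<close> for some compact \<open>C B \<subseteq> B\<close>. The mass vector now lies in
  the intersection of a box and a hyperplane. It is a convex combination of vectors with at most one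
  coordinate that is neither \<open>0\<close> nor \<open>m * \<alpha> (C B)\<close> (\<open>box_slice_induct\<close>). Such a vector is realised by
  an extremal measure: take the whole of \<open>C B\<close> in the full cells, and in the exceptional cell a subset
  together with a fraction of one point (\<open>subset_plus_partial_point\<close>). The fraction of a point makes
  up for the intermediate values that \<open>\<alpha>\<close> skips in the presence of atoms.
\<close>

section \<open>Intermediate values of a measure up to one point\<close>

text \<open>
  Bisection: between \<open>L\<close> and \<open>H\<close>, whose measures straddle \<open>t\<close>, the set \<open>L \<union> (H \<inter> B)\<close> replaces one of
  the two, for each \<open>B\<close> of a countable separating family in turn. After that step \<open>H - L\<close> lies on one
  side of \<open>B\<close>, so in the limit it cannot contain two points.
\<close>
lemma bisection_limit:
  assumes D: "countable D" "D \<subseteq> sets M"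
    and sep: "\<forall>x\<in>space M. \<forall>y\<in>space M. x \<noteq> y \<longrightarrow> (\<exists>B\<in>D. x \<in> B \<and> y \<notin> B)"
    and C: "C \<in> sets M" "emeasure M C \<noteq> \<infinity>" and t: "0 \<le> t" "t \<le> measure M C"
  obtains L H where "L \<in> sets M" "H \<in> sets M" "L \<subseteq> H" "H \<subseteq> C" "measure M L \<le> t" "t \<le> measure M H"
    "\<And>x y. x \<in> H - L \<Longrightarrow> y \<in> H - L \<Longrightarrow> x = y"
proof -
  \<comment> \<open>The empty set is added so that the enumerated family is nonempty.\<close>
  define B where "B = from_nat_into (insert {} D)"
  have rB: "range B = insert {} D"
    unfolding B_def using D by (intro range_from_nat_into) auto
  then have Bs: "B n \<in> sets M" for n using D(2) by (metis insert_iff rangeI sets.empty_sets subsetD)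
  define step where "step = (\<lambda>n (L, H).
     let mid = L \<union> (H \<inter> B n) in if t \<le> measure M mid then (L, mid) else (mid, H))"
  define P where "P = rec_nat ({}, C) step"
  define L where "L n = fst (P n)" for n
  define H where "H n = snd (P n)" for n
  have P0: "L 0 = {}" "H 0 = C" by (auto simp: L_def H_def P_def)
  have PS: "L (Suc n) = (if t \<le> measure M (L n \<union> (H n \<inter> B n)) then L n else L n \<union> (H n \<inter> B n))"
    "H (Suc n) = (if t \<le> measure M (L n \<union> (H n \<inter> B n)) then L n \<union> (H n \<inter> B n) else H n)" for n
    by (auto simp: L_def H_def P_def step_def Let_def split: prod.splits)
  have inv: "L n \<in> sets M \<and> H n \<in> sets M \<and> L n \<subseteq> H n \<and> H n \<subseteq> C \<and> measure M (L n) \<le> t \<and> t \<le> measure M (H n)" for n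
  proof (induction n)
    case 0 then show ?case using C t by (simp add: P0)
  next
    case (Suc n) then show ?case using Bs[of n] by (auto simp: PS)
  qed
  have incL: "incseq L" using inv by (intro incseq_SucI) (auto simp: PS)
  have decH: "decseq H" using inv by (intro decseq_SucI) (auto simp: PS)
  have fin: "emeasure M A \<noteq> \<infinity>" if "A \<subseteq> C" for A
    using emeasure_mono[OF that C(1)] C(2) by (auto simp: top_unique)
  have ranges: "range L \<subseteq> sets M" "range H \<subseteq> sets M" using inv by auto
  show thesis
  proof (rule that[of "\<Union>n. L n" "\<Inter>n. H n"])
    show "(\<Union>n. L n) \<in> sets M" "(\<Inter>n. H n) \<in> sets M" using inv by auto
    show "(\<Union>n. L n) \<subseteq> (\<Inter>n. H n)"
    proof clarify
      fix x i j assume "x \<in> L i"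
      then have "x \<in> L (max i j)" using incL unfolding incseq_def by (meson max.cobounded1 subsetD)
      then have "x \<in> H (max i j)" using inv by auto
      then show "x \<in> H j" using decH unfolding decseq_def by (meson max.cobounded2 subsetD)
    qed
    show "(\<Inter>n. H n) \<subseteq> C" using P0 by auto
    have "(\<Union>n. L n) \<subseteq> C" "(\<Inter>n. H n) \<subseteq> C" using inv by blast+
    note lim = Lim_measure_incseq[OF ranges(1) incL fin[OF this(1)]]
      Lim_measure_decseq[OF ranges(2) decH fin]
    show "measure M (\<Union>n. L n) \<le> t"
      by (rule LIMSEQ_le_const2[OF lim(1)]) (use inv in blast)
    show "t \<le> measure M (\<Inter>n. H n)"
      by (rule LIMSEQ_le_const[OF lim(2)]) (use inv in blast)+
    fix x y assume xy: "x \<in> (\<Inter>n. H n) - (\<Union>n. L n)" "y \<in> (\<Inter>n. H n) - (\<Union>n. L n)"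
    show "x = y"
    proof (rule ccontr)
      assume "x \<noteq> y"
      have "x \<in> H 0" "y \<in> H 0" using xy by auto
      then have "x \<in> space M" "y \<in> space M" using P0 C(1) sets.sets_into_space by auto
      then obtain B' where B': "B' \<in> D" "x \<in> B'" "y \<notin> B'" using sep \<open>x \<noteq> y\<close> by blast
      then obtain n where "B' = B n" using rB by (metis insertI2 rangeE)
      then have n: "x \<in> B n" "y \<notin> B n" using B' by auto
      have "x \<notin> L (Suc n)" "x \<in> H n" "y \<in> H (Suc n)" "y \<notin> L n" using xy by auto
      then show False using n by (auto simp: PS split: if_splits)
    qed
  qed
qed

text \<open>
  The substitute for Sierpinski's intermediate value theorem when the measure may have atoms. In the
  limit of the bisection the two sets differ by at most one point, and the missing mass is a
  fraction \<open>c\<close> of the mass of that point; if it is the whole mass, the point joins \<open>V\<close>. For \<open>c = 0\<close>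
  the point \<open>x\<close> is arbitrary.
\<close>
lemma subset_plus_partial_point:
  assumes D: "countable D" "D \<subseteq> sets M"
    and sep: "\<forall>x\<in>space M. \<forall>y\<in>space M. x \<noteq> y \<longrightarrow> (\<exists>B\<in>D. x \<in> B \<and> y \<notin> B)"
    and C: "C \<in> sets M" "emeasure M C \<noteq> \<infinity>" and t: "0 \<le> t" "t \<le> measure M C"
  obtains V x c where "V \<in> sets M" "V \<subseteq> C" "0 \<le> c" "c < (1::real)"
    "measure M V + c * measure M {x} = t" "c \<noteq> 0 \<Longrightarrow> x \<in> C - V \<and> {x} \<in> sets M"
proof -
  obtain L H where LH: "L \<in> sets M" "H \<in> sets M" "L \<subseteq> H" "H \<subseteq> C" "measure M L \<le> t" "t \<le> measure M H"
    and one: "\<And>x y. x \<in> H - L \<Longrightarrow> y \<in> H - L \<Longrightarrow> x = y"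
    using bisection_limit[OF assms] by blast
  show thesis
  proof (cases "t = measure M H")
    case True
    then show thesis using LH by (intro that[of H 0]) auto
  next
    case False
    then have "H \<noteq> L" using LH by auto
    then obtain x where x: "H - L = {x}" using LH one by blast
    have xs: "{x} \<in> sets M" using LH x by (metis sets.Diff)
    have H: "H = L \<union> {x}" "x \<notin> L" using x LH by auto
    have fin: "emeasure M A \<noteq> \<infinity>" if "A \<subseteq> C" for A
      using emeasure_mono[OF that C(1)] C(2) by (auto simp: top_unique)
    have mH: "measure M H = measure M L + measure M {x}"
      unfolding H(1) using H LH xs by (intro measure_Union fin) auto
    have pos: "0 < measure M {x}" using mH LH False by linarith
    define c where "c = (t - measure M L) / measure M {x}"
    have "c < 1" "0 \<le> c" using pos mH LH False by (auto simp: c_def)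
    moreover have "measure M L + c * measure M {x} = t" using pos by (simp add: c_def)
    ultimately show thesis using LH x xs by (intro that[of L c x]) auto
  qed
qed

section \<open>Convex combinations of points with one free coordinate\<close>

text \<open>
  A finite-dimensional Krein--Milman statement for the intersection of a box with a hyperplane of
  constant coordinate sum, phrased as an induction rule for predicates closed under convex
  combinations. If two coordinates are strictly between their bounds, shifting mass from one to the
  other, in either direction, until a bound is hit exhibits the point as a convex combination of two
  points with fewer such coordinates.
\<close>
lemma box_slice_induct:
  fixes q M :: "'j \<Rightarrow> real"
  assumes J: "finite J" "J \<noteq> {}" and q: "\<And>j. j \<in> J \<Longrightarrow> 0 \<le> q j \<and> q j \<le> M j"
    and mix: "\<And>a b t. Q a \<Longrightarrow> Q b \<Longrightarrow> t \<in> {0..1} \<Longrightarrow> Q (\<lambda>j. (1 - t) * a j + t * b j)"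
    and ext: "\<And>p k. k \<in> J \<Longrightarrow> (\<And>j. j \<in> J \<Longrightarrow> 0 \<le> p j \<and> p j \<le> M j) \<Longrightarrow> sum p J = sum q J \<Longrightarrow>
       (\<And>j. j \<in> J - {k} \<Longrightarrow> p j = 0 \<or> p j = M j) \<Longrightarrow> Q p"
  shows "Q q"
proof -
  define F where "F p = {j \<in> J. p j \<noteq> 0 \<and> p j \<noteq> M j}" for p
  have "\<lbrakk>\<And>j. j \<in> J \<Longrightarrow> 0 \<le> p j \<and> p j \<le> M j; sum p J = sum q J\<rbrakk> \<Longrightarrow> Q p" for p
  proof (induction "card (F p)" arbitrary: p rule: less_induct)
    case less
    note p = less.prems
    have fF: "finite (F p)" using J by (auto simp: F_def)
    show "Q p"
    proof (cases "\<exists>i k. i \<in> F p \<and> k \<in> F p \<and> i \<noteq> k")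
      case False
      then obtain k where "k \<in> J" "F p \<subseteq> {k}" using J by (metis (no_types, lifting) F_def all_not_in_conv insertI1 mem_Collect_eq subsetI)
      then show ?thesis using p by (intro ext[of k]) (auto simp: F_def)
    next
      case True
      then obtain i k where ik: "i \<in> F p" "k \<in> F p" "i \<noteq> k" by blast
      have iJ: "i \<in> J" "k \<in> J" using ik by (auto simp: F_def)
      have str: "0 < p i" "p i < M i" "0 < p k" "p k < M k"
        using ik p(1)[of i] p(1)[of k] by (auto simp: F_def order_less_le)
      \<comment> \<open>Mass moves from \<open>b\<close> to \<open>a\<close> until \<open>a\<close> is full or \<open>b\<close> is empty.\<close>
      have move: "Q (p(a := p a + s, b := p b - s))"
        if ab: "a \<in> F p" "b \<in> F p" "a \<noteq> b" and s: "s = min (M a - p a) (p b)" for a b s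
      proof -
        let ?p = "p(a := p a + s, b := p b - s)"
        have abJ: "a \<in> J" "b \<in> J" using ab by (auto simp: F_def)
        have "sum ?p J = sum p J"
          using J abJ ab(3) by (simp add: sum.remove[of J a] sum.remove[of "J - {a}" b])
        moreover have bd: "0 \<le> ?p j \<and> ?p j \<le> M j" if "j \<in> J" for j
          using p(1)[OF that] p(1)[OF abJ(1)] p(1)[OF abJ(2)] s ab(3) by (auto simp: min_def)
        moreover have "F ?p \<subset> F p"
        proof
          show "F ?p \<subseteq> F p" using ab by (auto simp: F_def)
          show "F ?p \<noteq> F p"
          proof
            assume "F ?p = F p"
            then have "a \<in> F ?p" "b \<in> F ?p" using ab by auto
            then show False using ab(3) s by (auto simp: F_def min_def split: if_splits)
          qed
        qed
        then have "card (F ?p) < card (F p)" using fF by (rule psubset_card_mono[rotated])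
        ultimately show ?thesis using p by (intro less.hyps) auto
      qed
      define s where "s = min (M i - p i) (p k)"
      define r where "r = min (M k - p k) (p i)"
      have sr: "0 < s" "0 < r" using str by (auto simp: s_def r_def)
      \<comment> \<open>The weights are inversely proportional to the displacements \<open>s\<close> and \<open>-r\<close>.\<close>
      have "Q (\<lambda>j. (1 - s / (s + r)) * (p(i := p i + s, k := p k - s)) j
                  + s / (s + r) * (p(k := p k + r, i := p i - r)) j)"
        using ik sr by (intro mix move) (auto simp: s_def r_def)
      also have "(\<lambda>j. (1 - s / (s + r)) * (p(i := p i + s, k := p k - s)) j
                  + s / (s + r) * (p(k := p k + r, i := p i - r)) j) = p"
      proof
        fix j
        have "1 - s / (s + r) = r / (s + r)" using sr by (simp add: field_simps)
        then show "(1 - s / (s + r)) * (p(i := p i + s, k := p k - s)) j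
                  + s / (s + r) * (p(k := p k + r, i := p i - r)) j = p j"
          using sr ik(3) by (auto simp: divide_simps) (auto simp: algebra_simps)
      qed
      finally show ?thesis .
    qed
  qed
  then show ?thesis using q by blast
qed

section \<open>Convex hulls of sets of measures\<close>

text \<open>
  The convex hull is generated by binary mixtures, so that an upper bound for a convex function on \<open>S\<close>
  extends to the hull by rule induction.
\<close>
inductive_set mix_hull :: "'a measure set \<Rightarrow> 'a measure set" for S where
  base: "\<mu> \<in> S \<Longrightarrow> \<mu> \<in> mix_hull S"
| mix: "\<mu> \<in> mix_hull S \<Longrightarrow> \<nu> \<in> mix_hull S \<Longrightarrow> t \<in> {0..1} \<Longrightarrow> mixture t \<mu> \<nu> \<in> mix_hull S"

lemma mix_hull_bounded_probs:
  assumes "sets \<alpha> = sets (borel_of X)" "S \<subseteq> bounded_probs X \<alpha> m" "\<mu> \<in> mix_hull S"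
  shows "\<mu> \<in> bounded_probs X \<alpha> m"
  using assms(3) by induction (use assms(2) in \<open>auto intro: mixture_bounded_probs[OF assms(1)]\<close>)

lemma measure_mixture:
  assumes "sets \<nu> = sets \<mu>" "prob_space \<mu>" "prob_space \<nu>" "A \<in> sets \<mu>" "t \<in> {0..1}"
  shows "measure (mixture t \<mu> \<nu>) A = (1 - t) * measure \<mu> A + t * measure \<nu> A"
proof -
  interpret \<mu>: prob_space \<mu> by fact
  interpret \<nu>: prob_space \<nu> by fact
  show ?thesis
    unfolding measure_def[of "mixture t \<mu> \<nu>"] emeasure_mixture[OF assms(1,4)]
    using assms(5) by (simp add: \<mu>.emeasure_eq_measure \<nu>.emeasure_eq_measure
        ennreal_mult[symmetric] ennreal_plus[symmetric] del: ennreal_plus)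
qed

section \<open>Borel sets and measures on Polish spaces\<close>

lemma open_in_borel:
  assumes "sets \<alpha> = sets (borel_of X)" "openin X U" shows "U \<in> sets \<alpha>"
  using assms openin_subset unfolding borel_of_def
  by (subst assms(1), subst borel_of_def, subst sets_measure_of) (auto dest: openin_subset)

lemma closed_in_borel:
  assumes "sets \<alpha> = sets (borel_of X)" "closedin X U" shows "U \<in> sets \<alpha>"
proof -
  have "space \<alpha> - (topspace X - U) \<in> sets \<alpha>"
    using assms by (intro sets.compl_sets open_in_borel[OF assms(1)]) auto
  then show ?thesis using assms closedin_subset[OF assms(2)] by (simp add: space_eq_topspace double_diff)
qed

lemma continuous_borel_measurable:
  assumes "sets \<alpha> = sets (borel_of X)" "continuous_map X euclideanreal f"
  shows "f \<in> borel_measurable \<alpha>"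
proof (rule borel_measurableI)
  fix V :: "real set" assume "open V"
  then have "openin X {x \<in> topspace X. f x \<in> V}"
    using assms(2) by (intro openin_continuous_map_preimage) auto
  moreover have "{x \<in> topspace X. f x \<in> V} = f -` V \<inter> space \<alpha>"
    using space_eq_topspace[OF assms(1)] by auto
  ultimately show "f -` V \<inter> space \<alpha> \<in> sets \<alpha>" using open_in_borel[OF assms(1)] by simp
qed

lemma polish_Hausdorff: "polish_topology X \<Longrightarrow> Hausdorff_space X"
  by (auto simp: polish_topology_def completely_metrizable_imp_metrizable_space
      metrizable_imp_Hausdorff_space)

lemma compact_in_borel:
  assumes "polish_topology X" "sets \<alpha> = sets (borel_of X)" "compactin X K" shows "K \<in> sets \<alpha>"
  using assms by (intro closed_in_borel compactin_imp_closedin polish_Hausdorff)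

lemma singleton_in_borel:
  assumes "polish_topology X" "sets \<alpha> = sets (borel_of X)" "x \<in> topspace X" shows "{x} \<in> sets \<alpha>"
  using assms by (intro compact_in_borel) auto

text \<open>The balls of radius \<open>1 / (n + 1)\<close> around the points of a countable dense set.\<close>
lemma countable_separating_open:
  assumes "polish_topology X"
  obtains D where "countable D" "\<And>B. B \<in> D \<Longrightarrow> openin X B"
    "\<And>x y. x \<in> topspace X \<Longrightarrow> y \<in> topspace X \<Longrightarrow> x \<noteq> y \<Longrightarrow> \<exists>B\<in>D. x \<in> B \<and> y \<notin> B"
proof -
  obtain Y d where Y: "Metric_space Y d" "X = Metric_space.mtopology Y d"
    using assms completely_metrizable_imp_metrizable_space
    unfolding polish_topology_def metrizable_space_def by blast
  interpret Metric_space Y d by fact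
  obtain Q where Q: "countable Q" "Q \<subseteq> Y" "mtopology closure_of Q = Y"
    using assms Y(2) by (auto simp: polish_topology_def separable_space_def)
  define D where "D = (\<lambda>(z, n). mball z (1 / Suc n)) ` (Q \<times> (UNIV :: nat set))"
  show thesis
  proof (rule that[of D])
    show "countable D" unfolding D_def using Q(1) by auto
    show "openin X B" if "B \<in> D" for B using that Y(2) by (auto simp: D_def)
    fix x y assume xy: "x \<in> topspace X" "y \<in> topspace X" "x \<noteq> y"
    then have xyY: "x \<in> Y" "y \<in> Y" using Y(2) by auto
    then have "0 < d x y" using xy(3) by simp
    then obtain n where n: "1 / Suc n < d x y / 2"
      using reals_Archimedean[of "d x y / 2"] by (auto simp: field_simps)
    have "x \<in> mtopology closure_of Q" using Q(3) xyY by simp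
    then obtain z where z: "z \<in> Q" "z \<in> mball x (1 / Suc n)"
      unfolding metric_closure_of by (auto dest!: spec[of _ "1 / Suc n"])
    have "y \<notin> mball z (1 / Suc n)"
      using triangle[of x z y] z n xyY commute[of x z] by (auto simp: mball_def)
    moreover have "x \<in> mball z (1 / Suc n)" using z xyY by (simp add: commute)
    ultimately show "\<exists>B\<in>D. x \<in> B \<and> y \<notin> B" using z by (auto simp: D_def intro!: bexI[of _ "(z, n)"])
  qed
qed

text \<open>
  Points have finite measure by \<open>\<sigma>\<close>-finiteness, so outer regularity gives each point a neighbourhood
  of finite measure.
\<close>
lemma compact_finite_measure:
  assumes pm: "polish_measure_space X \<alpha>" and K: "compactin X K"
  shows "emeasure \<alpha> K < \<infinity>"
proof -
  have s: "sets \<alpha> = sets (borel_of X)" and pt: "polish_topology X"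
    using pm by (auto simp: polish_measure_space_def)
  interpret sigma_finite_measure \<alpha> using pm by (simp add: polish_measure_space_def)
  have "\<exists>U. openin X U \<and> x \<in> U \<and> emeasure \<alpha> U < \<infinity>" if "x \<in> K" for x
  proof -
    have x: "x \<in> topspace X" using that K compactin_subset_topspace by blast
    obtain A where A: "range A \<subseteq> sets \<alpha>" "(\<Union>i. A i) = space \<alpha>" "\<And>i::nat. emeasure \<alpha> (A i) \<noteq> \<infinity>"
      using sigma_finite by blast
    then obtain i where i: "x \<in> A i" using x space_eq_topspace[OF s] by (metis UN_E)
    have "emeasure \<alpha> {x} \<le> emeasure \<alpha> (A i)" using A(1) i by (intro emeasure_mono) auto
    then have "emeasure \<alpha> {x} < \<infinity>" using A(3)[of i] by (simp add: less_top order_le_less_trans)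
    moreover have "emeasure \<alpha> {x} = (INF U\<in>{U. openin X U \<and> {x} \<subseteq> U}. emeasure \<alpha> U)"
      using pm singleton_in_borel[OF pt s x] unfolding polish_measure_space_def regular_measure_def by blast
    ultimately show ?thesis by (auto simp: INF_less_iff)
  qed
  then obtain U where U: "\<And>x. x \<in> K \<Longrightarrow> openin X (U x) \<and> x \<in> U x \<and> emeasure \<alpha> (U x) < \<infinity>" by metis
  have "\<exists>F. finite F \<and> F \<subseteq> U ` K \<and> K \<subseteq> \<Union>F"
    using K U unfolding compactin_def by (elim conjE allE[of _ "U ` K"]) blast
  then obtain F where F: "finite F" "F \<subseteq> U ` K" "K \<subseteq> \<Union>F" by blast
  have Fs: "F \<subseteq> sets \<alpha>" using F(2) U open_in_borel[OF s] by blast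
  then have "emeasure \<alpha> K \<le> emeasure \<alpha> (\<Union>x\<in>F. x)"
    using F by (intro emeasure_mono) auto
  also have "\<dots> \<le> (\<Sum>V\<in>F. emeasure \<alpha> V)" using F(1) Fs by (intro emeasure_subadditive_finite) auto
  also have "\<dots> < \<infinity>" using F(1,2) U by (auto simp: ennreal_sum_less_top)
  finally show ?thesis .
qed

section \<open>Prescribing the masses of the cells of a partition\<close>

lemma sum_measure_partition:
  assumes P: "finite P" "partition_on (space \<nu>) P" "P \<subseteq> sets \<nu>" and A: "A \<in> sets \<nu>"
  shows "(\<Sum>B\<in>P. emeasure \<nu> (A \<inter> B)) = emeasure \<nu> A"
proof -
  have "(\<Sum>B\<in>P. emeasure \<nu> (A \<inter> B)) = emeasure \<nu> (\<Union>B\<in>P. A \<inter> B)"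
    using P A partition_onD2[OF P(2)] by (intro sum_emeasure) (auto simp: disjoint_family_on_def disjoint_def)
  also have "(\<Union>B\<in>P. A \<inter> B) = A"
    using partition_onD1[OF P(2)] sets.sets_into_space[OF A] by auto
  finally show ?thesis .
qed

lemma sum_prob_partition:
  assumes "finite P" "partition_on (space \<nu>) P" "P \<subseteq> sets \<nu>" and "prob_space \<nu>"
  shows "(\<Sum>B\<in>P. measure \<nu> B) = 1"
proof -
  interpret prob_space \<nu> by fact
  have "(\<Sum>B\<in>P. emeasure \<nu> (space \<nu> \<inter> B)) = 1"
    using sum_measure_partition[OF assms(1-3), of "space \<nu>"] by (simp add: emeasure_space_1)
  moreover have "space \<nu> \<inter> B = B" if "B \<in> P" for B using partition_onD1[OF assms(2)] that by auto
  ultimately have "(\<Sum>B\<in>P. ennreal (measure \<nu> B)) = 1" by (simp add: emeasure_eq_measure)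
  then show ?thesis by (simp add: sum_ennreal sum_nonneg)
qed

text \<open>
  The extremal measure realising a mass vector with at most one free cell \<open>k\<close>. Its set \<open>U\<close> consists
  of \<open>C B\<close> for the full cells \<open>B\<close> and of a subset \<open>V\<close> of \<open>C k\<close>; a fraction of a point of \<open>C k - V\<close> provides
  the rest of the mass of \<open>k\<close>.
\<close>
lemma extremal_with_masses:
  assumes pm: "polish_measure_space X \<alpha>" and r: "m = ennreal r" "0 < r"
    and big: "1 < m * emeasure \<alpha> (topspace X)"
    and P: "finite P" "partition_on (topspace X) P" "P \<subseteq> sets \<alpha>"
    and C: "\<And>B. B \<in> P \<Longrightarrow> compactin X (C B) \<and> C B \<subseteq> B"
    and p: "\<And>B. B \<in> P \<Longrightarrow> 0 \<le> p B \<and> p B \<le> r * measure \<alpha> (C B)" "sum p P = 1"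
    and k: "k \<in> P" and ext: "\<And>B. B \<in> P - {k} \<Longrightarrow> p B = 0 \<or> p B = r * measure \<alpha> (C B)"
  shows "\<exists>\<nu>\<in>extremal_probs X \<alpha> m. \<forall>B\<in>P. measure \<nu> B = p B"
proof -
  have s: "sets \<alpha> = sets (borel_of X)" and pt: "polish_topology X"
    using pm by (auto simp: polish_measure_space_def)
  have sp: "space \<alpha> = topspace X" using space_eq_topspace[OF s] .
  have Cs: "C B \<in> sets \<alpha>" "emeasure \<alpha> (C B) \<noteq> \<infinity>" if "B \<in> P" for B
    using C[OF that] compact_in_borel[OF pt s] compact_finite_measure[OF pm] by (auto simp: less_top)
  have disj: "B = B'" if "B \<in> P" "B' \<in> P" "x \<in> B" "x \<in> B'" for B B' x
    using partition_onD2[OF P(2)] that unfolding disjoint_def by blast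
  obtain D where D: "countable D" "\<And>B. B \<in> D \<Longrightarrow> openin X B"
    "\<And>x y. x \<in> topspace X \<Longrightarrow> y \<in> topspace X \<Longrightarrow> x \<noteq> y \<Longrightarrow> \<exists>B\<in>D. x \<in> B \<and> y \<notin> B"
    using countable_separating_open[OF pt] by metis
  have Ds: "D \<subseteq> sets \<alpha>" using D(2) open_in_borel[OF s] by blast
  have sep: "\<forall>x\<in>space \<alpha>. \<forall>y\<in>space \<alpha>. x \<noteq> y \<longrightarrow> (\<exists>B\<in>D. x \<in> B \<and> y \<notin> B)"
    using D(3) sp by simp
  have tt: "0 \<le> p k / r" "p k / r \<le> measure \<alpha> (C k)" using p(1)[OF k] r by (auto simp: field_simps)
  obtain V z c where V: "V \<in> sets \<alpha>" "V \<subseteq> C k" and c: "0 \<le> c" "c < (1::real)"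
    and mass: "measure \<alpha> V + c * measure \<alpha> {z} = p k / r"
    and z: "c \<noteq> 0 \<Longrightarrow> z \<in> C k - V \<and> {z} \<in> sets \<alpha>"
    using subset_plus_partial_point[OF D(1) Ds sep Cs[OF k] tt] by metis
  define U where "U = V \<union> (\<Union>B\<in>{B \<in> P - {k}. p B \<noteq> 0}. C B)"
  have Us: "U \<in> sets \<alpha>" unfolding U_def using V P(1) Cs by (intro sets.Un sets.finite_UN) auto
  define K where "K = (\<Union>B\<in>P. C B)"
  have K: "compactin X K" unfolding K_def using P(1) C by (auto intro: compactin_Union)
  have UK: "U \<subseteq> K" using V k by (auto simp: U_def K_def)
  have UB: "U \<inter> B = (if B = k then V else if p B = 0 then {} else C B)" if "B \<in> P" for B
  proof -
    have other: "C B' \<inter> B = {}" if "B' \<in> P" "B' \<noteq> B" for B'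
      using C[OF that(1)] disj[OF that(1) \<open>B \<in> P\<close>] that(2) by blast
    have eqs: "U \<inter> B = (V \<inter> B) \<union> (\<Union>B'\<in>{B' \<in> P - {k}. p B' \<noteq> 0}. C B' \<inter> B)" "C B \<inter> B = C B"
      using C[OF that] by (auto simp: U_def)
    have "V \<inter> B = (if B = k then V else {})"
      using other[of k] k V C[OF k] by auto
    moreover have "(\<Union>B'\<in>{B' \<in> P - {k}. p B' \<noteq> 0}. C B' \<inter> B) = (if B = k \<or> p B = 0 then {} else C B)"
      using other eqs(2) that by (auto split: if_splits)
    ultimately show ?thesis using eqs(1) by simp
  qed
  have VF: "emeasure \<alpha> V = ennreal (measure \<alpha> V)" and zF: "c \<noteq> 0 \<Longrightarrow> emeasure \<alpha> {z} = ennreal (measure \<alpha> {z})"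
  proof -
    have "emeasure \<alpha> A = ennreal (measure \<alpha> A)" if "A \<subseteq> C k" for A
      using emeasure_mono[OF that Cs(1)[OF k]] Cs(2)[OF k]
      by (intro emeasure_eq_ennreal_measure) (auto simp: top_unique)
    then show "emeasure \<alpha> V = ennreal (measure \<alpha> V)" "c \<noteq> 0 \<Longrightarrow> emeasure \<alpha> {z} = ennreal (measure \<alpha> {z})"
      using V z by auto
  qed
  let ?h = "\<lambda>x y. m * indicator U y + ennreal (r * c) * indicator {x} y"
  define \<nu> where "\<nu> = density \<alpha> (?h z)"
  have hm: "?h z \<in> borel_measurable \<alpha>"
  proof (cases "c = 0")
    case False
    then have "{z} \<in> sets \<alpha>" using z by simp
    then show ?thesis using Us by measurable
  qed (use Us in auto)
  have em: "emeasure \<nu> A = m * emeasure \<alpha> (U \<inter> A) + ennreal (r * c) * emeasure \<alpha> ({z} \<inter> A)"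
    if A: "A \<in> sets \<alpha>" for A
  proof -
    have "emeasure \<nu> A = (\<integral>\<^sup>+y. m * indicator (U \<inter> A) y + ennreal (r * c) * indicator ({z} \<inter> A) y \<partial>\<alpha>)"
      unfolding \<nu>_def emeasure_density[OF hm A]
      by (intro nn_integral_cong) (auto simp: indicator_def)
    also have "\<dots> = m * emeasure \<alpha> (U \<inter> A) + ennreal (r * c) * emeasure \<alpha> ({z} \<inter> A)"
    proof (cases "c = 0")
      case True
      then show ?thesis using Us A by (simp add: nn_integral_cmult_indicator)
    next
      case False
      then have "{z} \<inter> A \<in> sets \<alpha>" using z A by auto
      then show ?thesis using Us A by (simp add: nn_integral_add nn_integral_cmult_indicator)
    qed
    finally show ?thesis .
  qed
  have nuB: "emeasure \<nu> B = ennreal (p B)" if B: "B \<in> P" for B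
  proof (cases "B = k")
    case True
    have Ik: "c \<noteq> 0 \<Longrightarrow> {z} \<inter> k = {z}" using z C[OF k] by auto
    have "ennreal (r * c) * emeasure \<alpha> ({z} \<inter> k) = ennreal (r * (c * measure \<alpha> {z}))"
      using zF Ik r c by (cases "c = 0") (auto simp: ennreal_mult[symmetric] mult.assoc)
    moreover have "m * emeasure \<alpha> (U \<inter> k) = ennreal (r * measure \<alpha> V)"
      using UB[OF k] VF r by (simp add: ennreal_mult)
    ultimately have "emeasure \<nu> k = ennreal (r * measure \<alpha> V + r * (c * measure \<alpha> {z}))"
      using em[of k] k P(3) r c by (subst ennreal_plus) auto
    also have "r * measure \<alpha> V + r * (c * measure \<alpha> {z}) = p k"
      using mass r by (simp add: distrib_left[symmetric])
    finally show ?thesis using True by simp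
  next
    case False
    have "ennreal (r * c) * emeasure \<alpha> ({z} \<inter> B) = 0"
    proof (cases "c = 0")
      case False
      then have "z \<in> k" using z C[OF k] by auto
      then have "z \<notin> B" using disj[OF B k] \<open>B \<noteq> k\<close> by blast
      then show ?thesis by simp
    qed simp
    then have "emeasure \<nu> B = m * emeasure \<alpha> (U \<inter> B)" using em[OF subsetD[OF P(3) B]] by simp
    also have "\<dots> = ennreal (p B)"
    proof (cases "p B = 0")
      case True
      then show ?thesis using UB[OF B] False by simp
    next
      case nz: False
      have "emeasure \<alpha> (U \<inter> B) = ennreal (measure \<alpha> (C B))"
        using UB[OF B] nz False Cs(2)[OF B] by (simp add: emeasure_eq_ennreal_measure)
      moreover have "p B = r * measure \<alpha> (C B)" using ext[of B] B False nz by simp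
      ultimately show ?thesis using r by (simp add: ennreal_mult)
    qed
    finally show ?thesis .
  qed
  have sn: "sets \<nu> = sets \<alpha>" "space \<nu> = topspace X" by (auto simp: \<nu>_def sp)
  have "emeasure \<nu> (space \<nu>) = (\<Sum>B\<in>P. emeasure \<nu> (space \<nu> \<inter> B))"
    using P sn sets.top[of \<nu>] by (intro sum_measure_partition[symmetric]) auto
  also have "\<dots> = (\<Sum>B\<in>P. ennreal (p B))"
    using nuB partition_onD1[OF P(2)] sn by (intro sum.cong refl) (metis Sup_upper inf_absorb2)
  also have "\<dots> = 1" using p by (subst sum_ennreal) auto
  finally have n1: "emeasure \<nu> (space \<nu>) = 1" .
  then have \<nu>p: "\<nu> \<in> borel_probs X" using s sn by (auto simp: borel_probs_def intro: prob_spaceI)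
  \<comment> \<open>If no partial point is needed, any point outside \<open>U\<close> may serve as \<open>x\<close>. There is one, because
    \<open>U\<close> then has measure \<open>1 / m\<close>, less than that of the whole space.\<close>
  have "\<exists>x \<in> topspace X - U. \<nu> = density \<alpha> (?h x)"
  proof (cases "c = 0")
    case True
    have "U \<noteq> topspace X"
    proof
      assume "U = topspace X"
      then have "emeasure \<nu> (space \<nu>) = m * emeasure \<alpha> (topspace X)"
        using em[of "topspace X"] sn True sets.top[of \<alpha>] by (simp add: sp)
      then show False using n1 big by simp
    qed
    moreover have "U \<subseteq> topspace X" using Us sp sets.sets_into_space by metis
    ultimately obtain x where "x \<in> topspace X - U" by blast
    then show ?thesis using True by (intro bexI[of _ x]) (auto simp: \<nu>_def)
  next
    case False
    then have "z \<in> C k" "z \<notin> V" using z by auto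
    moreover have "z \<in> k" using \<open>z \<in> C k\<close> C[OF k] by auto
    ultimately have "z \<notin> U" using UB[OF k] by auto
    moreover have "z \<in> topspace X" using \<open>z \<in> k\<close> k partition_onD1[OF P(2)] by auto
    ultimately show ?thesis by (auto simp: \<nu>_def)
  qed
  then obtain x where x: "x \<in> topspace X - U" "\<nu> = density \<alpha> (?h x)" by (elim bexE)
  have "ennreal (r * c) < m" using r c by (simp add: ennreal_less_iff)
  then have "\<exists>U c x K. U \<in> sets \<alpha> \<and> compactin X K \<and> U \<subseteq> K \<and> c < m \<and> x \<in> topspace X - U \<and>
      \<nu> = density \<alpha> (\<lambda>y. m * indicator U y + c * indicator {x} y)"
    using Us K UK x
    by - (rule exI[of _ U], rule exI[of _ "ennreal (r * c)"], rule exI[of _ x], rule exI[of _ K],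
      intro conjI; assumption)
  with \<nu>p have "\<nu> \<in> {\<mu> \<in> borel_probs X. \<exists>U c x K. U \<in> sets \<alpha> \<and> compactin X K \<and> U \<subseteq> K \<and> c < m \<and>
      x \<in> topspace X - U \<and> \<mu> = density \<alpha> (\<lambda>y. m * indicator U y + c * indicator {x} y)}"
    by (intro CollectI conjI)
  then have "\<nu> \<in> extremal_probs X \<alpha> m" unfolding extremal_probs_def using big r by simp
  moreover have "measure \<nu> B = p B" if "B \<in> P" for B
    using nuB[OF that] p(1)[OF that] by (simp add: measure_def)
  ultimately show ?thesis by blast
qed

text \<open>
  On \<open>\<alpha>\<close>-null sets the bound comes from absolute continuity, and on sets of infinite measure from
  \<open>m > 0\<close>; the quotients in \<^const>\<open>max_density\<close> say nothing there.
\<close>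
lemma emeasure_le_density_bound:
  assumes "\<mu> \<in> bounded_probs X \<alpha> m" "0 < m" "m \<noteq> \<infinity>" "A \<in> sets \<alpha>" "sets \<alpha> = sets (borel_of X)"
  shows "emeasure \<mu> A \<le> m * emeasure \<alpha> A"
proof -
  consider "emeasure \<alpha> A = 0" | "emeasure \<alpha> A = \<infinity>" | "emeasure \<alpha> A \<noteq> 0" "emeasure \<alpha> A \<noteq> \<infinity>"
    by blast
  then show ?thesis
  proof cases
    case 1
    then have "A \<in> null_sets \<alpha>" using assms(4) by auto
    then have "A \<in> null_sets \<mu>"
      using assms(1,3) unfolding bounded_probs_def absolutely_continuous_def by (auto simp: less_top)
    then show ?thesis by auto
  next
    case 2
    then show ?thesis using assms(2) by (simp add: ennreal_mult_top)
  next
    case 3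
    then have "emeasure \<mu> A / emeasure \<alpha> A \<le> m"
      using assms unfolding bounded_probs_def max_density_def by (auto simp: SUP_le_iff zero_less_iff_neq_zero)
    then have "emeasure \<alpha> A * (emeasure \<mu> A / emeasure \<alpha> A) \<le> emeasure \<alpha> A * m" by (intro mult_left_mono) auto
    moreover have "emeasure \<alpha> A * (emeasure \<mu> A / emeasure \<alpha> A) = emeasure \<mu> A"
      using 3 by (simp add: ennreal_times_divide mult.commute[of "emeasure \<alpha> A"] mult_divide_eq_ennreal)
    ultimately show ?thesis by (simp add: mult.commute)
  qed
qed

text \<open>
  Closure under convex combinations of the mass vectors that are realised in the hull: the
  hypothesis of \<open>box_slice_induct\<close>.
\<close>
lemma mix_hull_masses:
  assumes S: "\<And>\<nu>. \<nu> \<in> S \<Longrightarrow> \<nu> \<in> borel_probs X" and P: "P \<subseteq> sets (borel_of X)"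
    and a: "\<exists>\<nu>\<in>mix_hull S. \<forall>B\<in>P. measure \<nu> B = a B" and b: "\<exists>\<nu>\<in>mix_hull S. \<forall>B\<in>P. measure \<nu> B = b B"
    and t: "t \<in> {0..1}"
  shows "\<exists>\<nu>\<in>mix_hull S. \<forall>B\<in>P. measure \<nu> B = (1 - t) * a B + t * b B"
proof -
  have prob: "\<nu> \<in> borel_probs X" if "\<nu> \<in> mix_hull S" for \<nu>
  proof -
    have "S \<subseteq> bounded_probs X (borel_of X) \<infinity>" using S by (auto simp: bounded_probs_def)
    from mix_hull_bounded_probs[OF refl this that] show ?thesis by (simp add: bounded_probs_def)
  qed
  obtain \<nu> \<nu>' where n: "\<nu> \<in> mix_hull S" "\<forall>B\<in>P. measure \<nu> B = a B" "\<nu>' \<in> mix_hull S" "\<forall>B\<in>P. measure \<nu>' B = b B"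
    using a b by blast
  have "measure (mixture t \<nu> \<nu>') B = (1 - t) * measure \<nu> B + t * measure \<nu>' B" if "B \<in> P" for B
    using prob[OF n(1)] prob[OF n(3)] P that t by (intro measure_mixture) (auto simp: borel_probs_def)
  then have "\<forall>B\<in>P. measure (mixture t \<nu> \<nu>') B = (1 - t) * a B + t * b B" using n(2,4) by simp
  then show ?thesis using mix_hull.mix[OF n(1,3) t] by blast
qed

text \<open>
  Within the unit cube, a vector of total mass one with at most one free coordinate is a unit
  vector, and the Dirac measure at any point of the corresponding cell realises it.
\<close>
lemma extremal_hull_masses_point:
  assumes pt: "polish_topology X" and s: "sets \<alpha> = sets (borel_of X)"
    and P: "finite P" "partition_on (topspace X) P" "P \<subseteq> sets \<alpha>"
    and q: "\<And>B. B \<in> P \<Longrightarrow> 0 \<le> q B" "sum q P = 1"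
  shows "\<exists>\<nu>\<in>mix_hull (extremal_probs X \<alpha> \<infinity>). \<forall>B\<in>P. measure \<nu> B = q B"
proof (rule box_slice_induct[where J=P and M="\<lambda>_. 1" and q=q])
  let ?S = "extremal_probs X \<alpha> \<infinity>"
  have Sb: "\<nu> \<in> borel_probs X" if "\<nu> \<in> ?S" for \<nu>
    using extremal_probs_subset[OF pt s] that by (auto simp: bounded_probs_def)
  show "finite P" by fact
  show "P \<noteq> {}" using q(2) by auto
  show "0 \<le> q B \<and> q B \<le> 1" if "B \<in> P" for B
    using q P(1) that member_le_sum[of B P q] by auto
  show "\<exists>\<nu>\<in>mix_hull ?S. \<forall>B\<in>P. measure \<nu> B = (1 - t) * a B + t * b B"
    if "\<exists>\<nu>\<in>mix_hull ?S. \<forall>B\<in>P. measure \<nu> B = a B" "\<exists>\<nu>\<in>mix_hull ?S. \<forall>B\<in>P. measure \<nu> B = b B" "t \<in> {0..1}" for a b t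
    using P(3) s by (intro mix_hull_masses[OF Sb _ that]) simp_all
  fix p k assume k: "k \<in> P" and p: "\<And>B. B \<in> P \<Longrightarrow> 0 \<le> p B \<and> p B \<le> 1" "sum p P = sum q P"
    "\<And>B. B \<in> P - {k} \<Longrightarrow> p B = 0 \<or> p B = 1"
  have "\<exists>B\<in>P. p B = 1"
  proof (rule ccontr)
    assume *: "\<not> (\<exists>B\<in>P. p B = 1)"
    then have "sum p (P - {k}) = 0" using p(3) by (intro sum.neutral) auto
    then have "p k = 1" using sum.remove[OF P(1) k, of p] p(2) q(2) by simp
    then show False using * k by auto
  qed
  then obtain B where B: "B \<in> P" "p B = 1" by blast
  have "sum p (P - {B}) = 0" using sum.remove[OF P(1) B(1), of p] p(2) q(2) B(2) by simp
  then have z: "p B' = 0" if "B' \<in> P" "B' \<noteq> B" for B'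
    using p(1) P(1) that by (subst (asm) sum_nonneg_eq_0_iff) auto
  have "B \<noteq> {}" using B(1) partition_onD3[OF P(2)] by auto
  then obtain x where x: "x \<in> B" by blast
  have xX: "x \<in> topspace X" using x B(1) partition_onD1[OF P(2)] by auto
  have "measure (return (borel_of X) x) B' = p B'" if "B' \<in> P" for B'
  proof (cases "B' = B")
    case True
    moreover have "B \<in> sets (borel_of X)" using B(1) P(3) s by auto
    ultimately show ?thesis using x B(2) by (simp add: measure_def)
  next
    case False
    then have "x \<notin> B'" using x B(1) that partition_onD2[OF P(2)] by (auto simp: disjoint_def)
    moreover have "B' \<in> sets (borel_of X)" using that P(3) s by auto
    ultimately show ?thesis using z[OF that False] by (simp add: measure_def)
  qed
  moreover have "return (borel_of X) x \<in> ?S" using xX by (auto simp: extremal_probs_def)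
  ultimately show "\<exists>\<nu>\<in>mix_hull ?S. \<forall>B\<in>P. measure \<nu> B = p B" using mix_hull.base by blast
qed

text \<open>
  The strict inequality \<open>q B < m * \<alpha> B\<close> leaves room to replace \<open>B\<close> by a compact subset that can still
  carry the mass \<open>q B\<close>, as inner regularity only approximates \<open>\<alpha> B\<close> from below.
\<close>
lemma extremal_hull_masses_density:
  assumes pm: "polish_measure_space X \<alpha>" and r: "m = ennreal r" "0 < r"
    and big: "1 < m * emeasure \<alpha> (topspace X)"
    and P: "finite P" "partition_on (topspace X) P" "P \<subseteq> sets \<alpha>"
    and q: "\<And>B. B \<in> P \<Longrightarrow> 0 \<le> q B" "sum q P = 1"
    and room: "\<And>B. B \<in> P \<Longrightarrow> q B = 0 \<or> ennreal (q B) < m * emeasure \<alpha> B"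
  shows "\<exists>\<nu>\<in>mix_hull (extremal_probs X \<alpha> m). \<forall>B\<in>P. measure \<nu> B = q B"
proof -
  let ?S = "extremal_probs X \<alpha> m"
  have s: "sets \<alpha> = sets (borel_of X)" and pt: "polish_topology X"
    using pm by (auto simp: polish_measure_space_def)
  have Sb: "\<nu> \<in> borel_probs X" if "\<nu> \<in> ?S" for \<nu>
    using extremal_probs_subset[OF pt s] that by (auto simp: bounded_probs_def)
  have "\<exists>C. compactin X C \<and> C \<subseteq> B \<and> q B \<le> r * measure \<alpha> C" if B: "B \<in> P" for B
  proof (cases "q B = 0")
    case True
    then show ?thesis by (intro exI[of _ "{}"]) auto
  next
    case False
    have "ennreal (q B) < m * (SUP K\<in>{K. compactin X K \<and> K \<subseteq> B}. emeasure \<alpha> K)"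
      using room[OF B] False pm B P(3) unfolding polish_measure_space_def regular_measure_def by auto
    also have "\<dots> = (SUP K\<in>{K. compactin X K \<and> K \<subseteq> B}. m * emeasure \<alpha> K)"
      by (rule SUP_mult_left_ennreal)
    finally obtain K where K: "compactin X K" "K \<subseteq> B" "ennreal (q B) < m * emeasure \<alpha> K"
      by (auto simp: less_SUP_iff)
    have "m * emeasure \<alpha> K = ennreal (r * measure \<alpha> K)"
      using compact_finite_measure[OF pm K(1)] r by (simp add: emeasure_eq_ennreal_measure less_top ennreal_mult)
    then have "q B \<le> r * measure \<alpha> K" using K(3) r by (simp add: ennreal_less_iff q(1)[OF B])
    then show ?thesis using K by blast
  qed
  then obtain C where C: "\<And>B. B \<in> P \<Longrightarrow> compactin X (C B) \<and> C B \<subseteq> B \<and> q B \<le> r * measure \<alpha> (C B)" by metis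
  show ?thesis
  proof (rule box_slice_induct[where J=P and M="\<lambda>B. r * measure \<alpha> (C B)" and q=q])
    show "finite P" by fact
    show "P \<noteq> {}" using q(2) by auto
    show "0 \<le> q B \<and> q B \<le> r * measure \<alpha> (C B)" if "B \<in> P" for B using q C that by auto
    show "\<exists>\<nu>\<in>mix_hull ?S. \<forall>B\<in>P. measure \<nu> B = (1 - t) * a B + t * b B"
      if "\<exists>\<nu>\<in>mix_hull ?S. \<forall>B\<in>P. measure \<nu> B = a B" "\<exists>\<nu>\<in>mix_hull ?S. \<forall>B\<in>P. measure \<nu> B = b B" "t \<in> {0..1}" for a b t
      using P(3) s by (intro mix_hull_masses[OF Sb _ that]) simp_all
    fix p k assume k: "k \<in> P" and p: "\<And>B. B \<in> P \<Longrightarrow> 0 \<le> p B \<and> p B \<le> r * measure \<alpha> (C B)" "sum p P = sum q P"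
      and ext: "\<And>B. B \<in> P - {k} \<Longrightarrow> p B = 0 \<or> p B = r * measure \<alpha> (C B)"
    have CB: "compactin X (C B) \<and> C B \<subseteq> B" if "B \<in> P" for B using C[OF that] by blast
    have "sum p P = 1" using p(2) q(2) by simp
    from extremal_with_masses[OF pm r big P CB p(1) this k ext]
    have "\<exists>\<nu>\<in>?S. \<forall>B\<in>P. measure \<nu> B = p B" by blast
    then show "\<exists>\<nu>\<in>mix_hull ?S. \<forall>B\<in>P. measure \<nu> B = p B" using mix_hull.base by blast
  qed
qed

text \<open>
  The masses of \<open>\<mu>\<close> itself may equal \<open>m * \<alpha> B\<close> on some cells. In the main case they are therefore mixed
  with those of the uniform distribution \<open>w\<close> on a compact set \<open>K\<close> with \<open>m * \<alpha> K > 1\<close>. The density of \<open>w\<close> is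
  at most \<open>1 / \<alpha> K < m\<close>, so the mixture satisfies the density bound strictly on every cell of positive
  finite measure.
\<close>
lemma extremal_hull_masses_approx:
  assumes pm: "polish_measure_space X \<alpha>" and m: "0 < m" and \<mu>: "\<mu> \<in> bounded_probs X \<alpha> m"
    and P: "finite P" "partition_on (topspace X) P" "P \<subseteq> sets \<alpha>" and \<delta>: "0 < \<delta>" "\<delta> \<le> 1"
  shows "\<exists>\<nu>\<in>mix_hull (extremal_probs X \<alpha> m). \<forall>B\<in>P. \<bar>measure \<nu> B - measure \<mu> B\<bar> \<le> \<delta>"
proof -
  have s: "sets \<alpha> = sets (borel_of X)" and pt: "polish_topology X"
    using pm by (auto simp: polish_measure_space_def)
  have sp: "space \<alpha> = topspace X" using space_eq_topspace[OF s] .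
  have \<mu>s: "sets \<mu> = sets \<alpha>" "space \<mu> = topspace X" "prob_space \<mu>"
    using \<mu> s space_eq_topspace[of \<mu> X] by (auto simp: bounded_probs_def borel_probs_def)
  interpret \<mu>: prob_space \<mu> by fact
  have pS: "(\<Sum>B\<in>P. measure \<mu> B) = 1" using P \<mu>s by (intro sum_prob_partition) auto
  consider "m = \<infinity>" | "m \<noteq> \<infinity>" "\<not> 1 < m * emeasure \<alpha> (topspace X)" | "m \<noteq> \<infinity>" "1 < m * emeasure \<alpha> (topspace X)"
    by blast
  then show ?thesis
  proof cases
    case 1
    obtain \<nu> where "\<nu> \<in> mix_hull (extremal_probs X \<alpha> \<infinity>)" "\<forall>B\<in>P. measure \<nu> B = measure \<mu> B"
      using extremal_hull_masses_point[OF pt s P measure_nonneg pS] by blast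
    then show ?thesis using 1 \<delta> by (intro bexI[of _ \<nu>]) auto
  next
    case 2
    then have "\<mu> \<in> extremal_probs X \<alpha> m" using \<mu> by (simp add: extremal_probs_def)
    then show ?thesis using \<delta> by (intro bexI[of _ \<mu>]) (auto intro: mix_hull.base)
  next
    case 3
    obtain r where r: "m = ennreal r" "0 < r"
      using 3(1) m by (cases m) auto
    have "1 < m * (SUP K\<in>{K. compactin X K \<and> K \<subseteq> topspace X}. emeasure \<alpha> K)"
      using 3(2) pm sets.top[of \<alpha>] sp unfolding polish_measure_space_def regular_measure_def by auto
    also have "\<dots> = (SUP K\<in>{K. compactin X K \<and> K \<subseteq> topspace X}. m * emeasure \<alpha> K)"
      by (rule SUP_mult_left_ennreal)
    finally obtain K where K: "compactin X K" "1 < m * emeasure \<alpha> K"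
      by (auto simp: less_SUP_iff)
    have Ks: "K \<in> sets \<alpha>" using compact_in_borel[OF pt s K(1)] .
    have fin: "emeasure \<alpha> (K \<inter> B) = ennreal (measure \<alpha> (K \<inter> B))" for B
    proof (rule emeasure_eq_ennreal_measure)
      have "emeasure \<alpha> (K \<inter> B) \<le> emeasure \<alpha> K" using Ks by (intro emeasure_mono) auto
      then show "emeasure \<alpha> (K \<inter> B) \<noteq> \<top>" using compact_finite_measure[OF pm K(1)] by (auto simp: top_unique)
    qed
    define a where "a = measure \<alpha> K"
    have "m * emeasure \<alpha> K = ennreal (r * a)" using fin[of UNIV] r by (simp add: a_def ennreal_mult)
    then have ra: "1 < r * a" using K(2) by (simp add: ennreal_less_iff[of 1, simplified])
    then have a: "0 < a" using r by (metis less_trans zero_less_mult_pos zero_less_one)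
    define w where "w B = measure \<alpha> (K \<inter> B) / a" for B
    define q where "q B = (1 - \<delta>) * measure \<mu> B + \<delta> * w B" for B
    have "ennreal (\<Sum>B\<in>P. measure \<alpha> (K \<inter> B)) = ennreal a"
      using sum_measure_partition[of P \<alpha> K] P sp Ks fin fin[of UNIV] by (simp add: a_def)
    then have "(\<Sum>B\<in>P. measure \<alpha> (K \<inter> B)) = a" using a by (subst (asm) ennreal_inj) (auto intro: sum_nonneg)
    then have wS: "(\<Sum>B\<in>P. w B) = 1" using a by (simp add: w_def sum_divide_distrib[symmetric])
    have w0: "0 \<le> w B" for B using a by (simp add: w_def)
    have w1: "w B \<le> 1" if "B \<in> P" for B
      using member_le_sum[of B P w] that P(1) w0 wS by auto
    have qS: "sum q P = 1"
      using pS wS by (simp add: q_def sum.distrib sum_distrib_left[symmetric])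
    have q0: "0 \<le> q B" for B using \<delta> w0[of B] by (simp add: q_def)
    have room: "q B = 0 \<or> ennreal (q B) < m * emeasure \<alpha> B" if B: "B \<in> P" for B
    proof (cases "emeasure \<alpha> B = \<infinity>")
      case True
      then show ?thesis using r by (simp add: ennreal_mult_top)
    next
      case False
      define b where "b = measure \<alpha> B"
      have Bs: "B \<in> sets \<alpha>" using B P(3) by auto
      have eb: "emeasure \<alpha> B = ennreal b" using False by (simp add: b_def emeasure_eq_ennreal_measure)
      have b0: "0 \<le> b" by (simp add: b_def)
      have "emeasure \<alpha> (K \<inter> B) \<le> emeasure \<alpha> B" using Bs by (intro emeasure_mono) auto
      then have "measure \<alpha> (K \<inter> B) \<le> b" using fin eb b0 by simp
      then have wb: "w B \<le> b / a" using a by (simp add: w_def divide_right_mono)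
      have "emeasure \<mu> B \<le> m * emeasure \<alpha> B"
        using emeasure_le_density_bound[OF \<mu> m 3(1) Bs s] .
      then have pb: "measure \<mu> B \<le> r * b"
        using r eb b0 by (simp add: \<mu>.emeasure_eq_measure ennreal_mult[symmetric])
      show ?thesis
      proof (cases "b = 0")
        case True
        then have "measure \<mu> B = 0" "w B = 0" using pb wb w0[of B] by (auto simp: order_antisym)
        then show ?thesis by (simp add: q_def)
      next
        case False
        then have "0 < b" using b0 by simp
        then have "b / a < r * b" using ra a by (simp add: field_simps)
        then have "w B < r * b" using wb by simp
        then have "\<delta> * w B < \<delta> * (r * b)" using \<delta> by simp
        moreover have "(1 - \<delta>) * measure \<mu> B \<le> (1 - \<delta>) * (r * b)" using \<delta> pb by (intro mult_left_mono) auto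
        ultimately have "q B < (1 - \<delta>) * (r * b) + \<delta> * (r * b)" unfolding q_def by linarith
        also have "\<dots> = r * b" by (simp add: algebra_simps)
        finally have "q B < r * b" .
        then show ?thesis using r eb b0 q0[of B] by (simp add: ennreal_mult[symmetric] ennreal_less_iff)
      qed
    qed
    obtain \<nu> where \<nu>: "\<nu> \<in> mix_hull (extremal_probs X \<alpha> m)" "\<forall>B\<in>P. measure \<nu> B = q B"
      using extremal_hull_masses_density[OF pm r 3(2) P q0 qS room] by blast
    have "\<bar>q B - measure \<mu> B\<bar> \<le> \<delta>" if "B \<in> P" for B
    proof -
      have "q B - measure \<mu> B = \<delta> * (w B - measure \<mu> B)" by (simp add: q_def algebra_simps)
      moreover have "\<bar>w B - measure \<mu> B\<bar> \<le> 1"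
        using w0[of B] w1[OF that] \<mu>.prob_le_1[of B] measure_nonneg[of \<mu> B] by linarith
      ultimately show ?thesis using \<delta> by (simp add: abs_mult mult_left_le)
    qed
    then show ?thesis using \<nu> by (intro bexI[of _ \<nu>]) auto
  qed
qed

section \<open>Weak density of the hull of the extremal measures\<close>

text \<open>The cells are the sets on which \<open>\<lfloor>f x / \<eta>\<rfloor>\<close> is constant for every \<open>f \<in> F\<close>.\<close>
lemma oscillation_partition:
  fixes F :: "('a \<Rightarrow> real) set"
  assumes F: "finite F" "\<And>f. f \<in> F \<Longrightarrow> f \<in> borel_measurable M" "\<And>f. f \<in> F \<Longrightarrow> bounded (f ` space M)"
    and \<eta>: "0 < \<eta>"
  obtains P where "finite P" "partition_on (space M) P" "P \<subseteq> sets M"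
    "\<And>B f x y. B \<in> P \<Longrightarrow> f \<in> F \<Longrightarrow> x \<in> B \<Longrightarrow> y \<in> B \<Longrightarrow> \<bar>f x - f y\<bar> \<le> \<eta>"
proof -
  define g where "g x = restrict (\<lambda>f. \<lfloor>f x / \<eta>\<rfloor>) F" for x
  define cell where "cell j = {x \<in> space M. g x = j}" for j
  have "\<exists>N. \<forall>x\<in>space M. \<bar>f x\<bar> \<le> N" if "f \<in> F" for f
    using F(3)[OF that] by (auto simp: bounded_iff)
  then obtain N where N: "\<And>f x. f \<in> F \<Longrightarrow> x \<in> space M \<Longrightarrow> \<bar>f x\<bar> \<le> N f" by metis
  have "g ` space M \<subseteq> (\<Pi>\<^sub>E f\<in>F. {\<lfloor>- N f / \<eta>\<rfloor>..\<lfloor>N f / \<eta>\<rfloor>})"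
  proof (rule image_subsetI, rule PiE_I)
    fix x f assume "x \<in> space M" "f \<in> F"
    then have "- N f \<le> f x" "f x \<le> N f" using N[of f x] by auto
    then have "- N f / \<eta> \<le> f x / \<eta>" "f x / \<eta> \<le> N f / \<eta>"
      using divide_right_mono[OF _ less_imp_le[OF \<eta>]] by blast+
    then show "g x f \<in> {\<lfloor>- N f / \<eta>\<rfloor>..\<lfloor>N f / \<eta>\<rfloor>}"
      using \<open>f \<in> F\<close> by (simp add: g_def floor_mono)
  qed (simp add: g_def)
  then have fin: "finite (g ` space M)" by (rule finite_subset) (auto intro!: finite_PiE F(1))
  have meas: "cell (g z) \<in> sets M" for z
  proof -
    have "cell (g z) = {x \<in> space M. \<forall>f\<in>F. \<lfloor>f x / \<eta>\<rfloor> = \<lfloor>f z / \<eta>\<rfloor>}"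
      by (auto simp: cell_def g_def fun_eq_iff restrict_def)
    also have "\<dots> \<in> sets M"
    proof (rule sets.sets_Collect_finite_All[OF _ F(1)])
      fix f assume "f \<in> F"
      then have [measurable]: "f \<in> borel_measurable M" using F(2) by simp
      show "{x \<in> space M. \<lfloor>f x / \<eta>\<rfloor> = \<lfloor>f z / \<eta>\<rfloor>} \<in> sets M" by measurable
    qed
    finally show ?thesis .
  qed
  show thesis
  proof (rule that[of "cell ` (g ` space M)"])
    show "finite (cell ` (g ` space M))" using fin by (rule finite_imageI)
    show "partition_on (space M) (cell ` (g ` space M))"
      by (rule partition_onI) (auto simp: cell_def disjnt_def)
    show "cell ` (g ` space M) \<subseteq> sets M" using meas by auto
    fix B f x y assume "B \<in> cell ` (g ` space M)" "f \<in> F" "x \<in> B" "y \<in> B"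
    then have "g x f = g y f" by (auto simp: cell_def)
    then have "\<lfloor>f x / \<eta>\<rfloor> = \<lfloor>f y / \<eta>\<rfloor>" using \<open>f \<in> F\<close> by (simp add: g_def)
    then have "\<bar>f x / \<eta> - f y / \<eta>\<bar> \<le> 1" by linarith
    then show "\<bar>f x - f y\<bar> \<le> \<eta>"
      using \<eta> by (simp add: diff_divide_distrib[symmetric] abs_divide)
  qed
qed

lemma integral_approx_by_masses:
  fixes f :: "'a \<Rightarrow> real"
  assumes "prob_space \<nu>" and f: "f \<in> borel_measurable \<nu>" "\<And>x. x \<in> space \<nu> \<Longrightarrow> \<bar>f x\<bar> \<le> c"
    and P: "finite P" "partition_on (space \<nu>) P" "P \<subseteq> sets \<nu>"
    and osc: "\<And>B x. B \<in> P \<Longrightarrow> x \<in> B \<Longrightarrow> \<bar>f x - v B\<bar> \<le> \<eta>"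
  shows "\<bar>(\<integral>x. f x \<partial>\<nu>) - (\<Sum>B\<in>P. v B * measure \<nu> B)\<bar> \<le> \<eta>"
proof -
  interpret prob_space \<nu> by fact
  let ?s = "\<lambda>x. \<Sum>B\<in>P. v B * indicator B x"
  have intf: "integrable \<nu> f" using f by (intro integrable_const_bound[of _ c]) auto
  have ints: "integrable \<nu> (\<lambda>x. v B * indicator B x)" if "B \<in> P" for B
    using P(3) that by (intro integrable_mult_right integrable_real_indicator) (auto simp: less_top[symmetric])
  have int_s: "(\<integral>x. ?s x \<partial>\<nu>) = (\<Sum>B\<in>P. v B * measure \<nu> B)"
    using ints P(3) by (subst Bochner_Integration.integral_sum) (auto intro!: sum.cong)
  have ints': "integrable \<nu> ?s" using ints by (rule Bochner_Integration.integrable_sum)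
  have le: "\<bar>f x - ?s x\<bar> \<le> \<eta>" if "x \<in> space \<nu>" for x
  proof -
    have "x \<in> \<Union>P" using that by (simp only: partition_onD1[OF P(2)])
    then obtain B where B: "B \<in> P" "x \<in> B" by (rule UnionE)
    have "x \<notin> B'" if "B' \<in> P" "B' \<noteq> B" for B'
      using B that partition_onD2[OF P(2)] by (auto simp: disjoint_def)
    then have "(\<Sum>B'\<in>P - {B}. v B' * indicator B' x) = 0" by (intro sum.neutral) auto
    then have "?s x = v B" using sum.remove[OF P(1) B(1), of "\<lambda>B. v B * indicator B x"] B(2) by simp
    then show ?thesis using osc[OF B] by simp
  qed
  have "\<bar>(\<integral>x. f x \<partial>\<nu>) - (\<integral>x. ?s x \<partial>\<nu>)\<bar> = \<bar>\<integral>x. f x - ?s x \<partial>\<nu>\<bar>"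
    using intf ints' by simp
  also have "\<dots> \<le> (\<integral>x. \<bar>f x - ?s x\<bar> \<partial>\<nu>)" by (rule integral_abs_bound)
  also have "\<dots> \<le> (\<integral>x. \<eta> \<partial>\<nu>)" using intf ints' le by (intro integral_mono) auto
  also have "\<dots> = \<eta>" by (simp add: prob_space)
  finally show ?thesis by (simp only: int_s)
qed

text \<open>
  The error is the sum of three parts of size at most \<open>\<epsilon> / 4\<close>: two from replacing \<open>f\<close> by a function
  constant on the cells, under \<open>\<nu>\<close> and under \<open>\<mu>\<close>, and one from the difference of the cell masses.
\<close>
lemma extremal_hull_weakly_dense:
  assumes pm: "polish_measure_space X \<alpha>" and m: "0 < m" and \<mu>: "\<mu> \<in> bounded_probs X \<alpha> m"
    and F: "finite F" "\<And>f. f \<in> F \<Longrightarrow> continuous_map X euclideanreal f \<and> bounded (f ` topspace X)"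
    and \<epsilon>: "0 < \<epsilon>"
  shows "\<exists>\<nu>\<in>mix_hull (extremal_probs X \<alpha> m). \<forall>f\<in>F. \<bar>(\<integral>x. f x \<partial>\<nu>) - (\<integral>x. f x \<partial>\<mu>)\<bar> < \<epsilon>"
proof -
  have s: "sets \<alpha> = sets (borel_of X)" and pt: "polish_topology X"
    using pm by (auto simp: polish_measure_space_def)
  have sp: "space \<alpha> = topspace X" using space_eq_topspace[OF s] .
  have "\<exists>N. \<forall>x\<in>topspace X. \<bar>f x\<bar> \<le> N" if "f \<in> F" for f
    using F(2)[OF that] by (auto simp: bounded_iff)
  then obtain N where N: "\<And>f x. f \<in> F \<Longrightarrow> x \<in> topspace X \<Longrightarrow> \<bar>f x\<bar> \<le> N f" by metis
  \<comment> \<open>A common bound for all test functions, made positive for the divisions below.\<close>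
  define c where "c = 1 + (\<Sum>f\<in>F. \<bar>N f\<bar>)"
  have c: "0 < c" by (auto simp: c_def intro!: add_pos_nonneg sum_nonneg)
  have fc: "\<bar>f x\<bar> \<le> c" if "f \<in> F" "x \<in> topspace X" for f x
    using N[OF that] member_le_sum[of f F "\<lambda>f. \<bar>N f\<bar>"] that F(1) by (auto simp: c_def)
  obtain P where P: "finite P" "partition_on (topspace X) P" "P \<subseteq> sets \<alpha>"
    and osc: "\<And>B f x y. B \<in> P \<Longrightarrow> f \<in> F \<Longrightarrow> x \<in> B \<Longrightarrow> y \<in> B \<Longrightarrow> \<bar>f x - f y\<bar> \<le> \<epsilon> / 4"
    by (rule oscillation_partition[of F \<alpha> "\<epsilon> / 4"])
      (use F continuous_borel_measurable[OF s] \<epsilon> sp in auto)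
  have "\<forall>B\<in>P. \<exists>x. x \<in> B" using partition_onD3[OF P(2)] by (metis ex_in_conv)
  then obtain b where b: "\<And>B. B \<in> P \<Longrightarrow> b B \<in> B" by metis
  define k where "k = 1 + real (card P)"
  have k: "0 < k" "real (card P) \<le> k" by (auto simp: k_def)
  define \<delta> where "\<delta> = min 1 (\<epsilon> / (4 * c * k))"
  have \<delta>: "0 < \<delta>" "\<delta> \<le> 1" "\<delta> \<le> \<epsilon> / (4 * c * k)" using \<epsilon> c k by (auto simp: \<delta>_def)
  have "real (card P) * c * \<delta> \<le> k * c * (\<epsilon> / (4 * c * k))"
    using c \<delta> k by (intro mult_mono) auto
  also have "\<dots> = \<epsilon> / 4" using c k by simp
  finally have small: "real (card P) * c * \<delta> \<le> \<epsilon> / 4" .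
  obtain \<nu> where \<nu>: "\<nu> \<in> mix_hull (extremal_probs X \<alpha> m)"
    and close: "\<And>B. B \<in> P \<Longrightarrow> \<bar>measure \<nu> B - measure \<mu> B\<bar> \<le> \<delta>"
    using extremal_hull_masses_approx[OF pm m \<mu> P \<delta>(1,2)] by blast
  have \<nu>b: "\<nu> \<in> bounded_probs X \<alpha> m"
    using mix_hull_bounded_probs[OF s extremal_probs_subset[OF pt s] \<nu>] .
  have approx: "\<bar>(\<integral>x. f x \<partial>\<rho>) - (\<Sum>B\<in>P. f (b B) * measure \<rho> B)\<bar> \<le> \<epsilon> / 4"
    if \<rho>: "\<rho> \<in> bounded_probs X \<alpha> m" and f: "f \<in> F" for \<rho> f
  proof -
    have l: "sets \<rho> = sets (borel_of X)" "prob_space \<rho>"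
      using \<rho> by (auto simp: bounded_probs_def borel_probs_def)
    show ?thesis
      using l P s fc[OF f] f b osc F(2)[OF f]
      by (intro integral_approx_by_masses[where c=c])
        (auto simp: space_eq_topspace continuous_borel_measurable)
  qed
  have "\<bar>(\<integral>x. f x \<partial>\<nu>) - (\<integral>x. f x \<partial>\<mu>)\<bar> < \<epsilon>" if f: "f \<in> F" for f
  proof -
    have "\<bar>(\<Sum>B\<in>P. f (b B) * measure \<nu> B) - (\<Sum>B\<in>P. f (b B) * measure \<mu> B)\<bar>
        = \<bar>\<Sum>B\<in>P. f (b B) * (measure \<nu> B - measure \<mu> B)\<bar>"
      by (simp add: sum_subtractf[symmetric] right_diff_distrib)
    also have "\<dots> \<le> (\<Sum>B\<in>P. \<bar>f (b B) * (measure \<nu> B - measure \<mu> B)\<bar>)" by (rule sum_abs)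
    also have "\<dots> \<le> (\<Sum>B\<in>P. c * \<delta>)"
    proof (rule sum_mono)
      fix B assume B: "B \<in> P"
      then have "b B \<in> topspace X" using b partition_onD1[OF P(2)] by auto
      then show "\<bar>f (b B) * (measure \<nu> B - measure \<mu> B)\<bar> \<le> c * \<delta>"
        unfolding abs_mult using fc[OF f] close[OF B] c by (intro mult_mono) auto
    qed
    also have "\<dots> \<le> \<epsilon> / 4" using small by (simp add: mult.assoc)
    finally show ?thesis using approx[OF \<nu>b f] approx[OF \<mu> f] \<epsilon> by linarith
  qed
  then show ?thesis using \<nu> by blast
qed

lemma weak_topology_neighbourhood:
  assumes "openin (weak_topology X) W" "\<mu> \<in> W"
  shows "\<exists>F \<epsilon>. finite F \<and> (\<forall>f\<in>F. continuous_map X euclideanreal f \<and> bounded (f ` topspace X)) \<and>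
    0 < \<epsilon> \<and> {\<nu> \<in> borel_probs X. \<forall>f\<in>F. \<bar>(\<integral>x. f x \<partial>\<nu>) - (\<integral>x. f x \<partial>\<mu>)\<bar> < \<epsilon>} \<subseteq> W"
  using openin_topology_generated_by[OF assms(1)[unfolded weak_topology_def]] assms(2)
proof (induction rule: generate_topology_on.induct)
  case Empty
  then show ?case by simp
next
  case (Int A B)
  then obtain F \<epsilon> G \<delta> where
    "finite F" "\<forall>f\<in>F. continuous_map X euclideanreal f \<and> bounded (f ` topspace X)" "0 < \<epsilon>"
    "{\<nu> \<in> borel_probs X. \<forall>f\<in>F. \<bar>(\<integral>x. f x \<partial>\<nu>) - (\<integral>x. f x \<partial>\<mu>)\<bar> < \<epsilon>} \<subseteq> A"
    "finite G" "\<forall>f\<in>G. continuous_map X euclideanreal f \<and> bounded (f ` topspace X)" "0 < \<delta>"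
    "{\<nu> \<in> borel_probs X. \<forall>f\<in>G. \<bar>(\<integral>x. f x \<partial>\<nu>) - (\<integral>x. f x \<partial>\<mu>)\<bar> < \<delta>} \<subseteq> B"
    by blast
  then show ?case
    by (intro exI[of _ "F \<union> G"] exI[of _ "min \<epsilon> \<delta>"] conjI) auto
next
  case (UN \<K>)
  then obtain A where A: "A \<in> \<K>" "\<mu> \<in> A" by blast
  show ?case using UN.IH[OF A] A(1) by blast
next
  case (Basis A)
  then obtain f V where f: "A = {\<mu> \<in> borel_probs X. (\<integral>x. f x \<partial>\<mu>) \<in> V}"
    "continuous_map X euclideanreal f" "bounded (f ` topspace X)" "open V" by blast
  then obtain e where "0 < e" "\<And>y. dist y (\<integral>x. f x \<partial>\<mu>) < e \<Longrightarrow> y \<in> V"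
    using Basis(2) unfolding open_dist by blast
  then show ?case using f by (intro exI[of _ "{f}"] exI[of _ e]) (auto simp: dist_real_def)
qed

section \<open>Maximisation over extremal measures\<close>

text \<open>
  The theorem for one space. If \<open>\<phi> \<le> a\<close> on the extremal measures, then \<open>\<phi> \<le> a\<close> on their hull by
  convexity, whereas the weakly open set of measures with \<open>\<phi> > a\<close> contains \<open>\<mu>\<close> and hence meets the hull.
\<close>
lemma convex_lsc_exceeds_on_extremal:
  assumes pm: "polish_measure_space X \<alpha>" and m: "0 < m" and \<mu>: "\<mu> \<in> bounded_probs X \<alpha> m"
    and convex: "\<And>\<nu>\<^sub>0 \<nu>\<^sub>1 t. \<nu>\<^sub>0 \<in> bounded_probs X \<alpha> m \<Longrightarrow> \<nu>\<^sub>1 \<in> bounded_probs X \<alpha> m \<Longrightarrow> t \<in> {0..1} \<Longrightarrow>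
      \<phi> (mixture t \<nu>\<^sub>0 \<nu>\<^sub>1) \<le> (1 - t) * \<phi> \<nu>\<^sub>0 + t * (\<phi> \<nu>\<^sub>1 :: real)"
    and lsc: "openin (subtopology (weak_topology X) (bounded_probs X \<alpha> m)) {\<nu> \<in> bounded_probs X \<alpha> m. a < \<phi> \<nu>}"
    and a: "a < \<phi> \<mu>"
  shows "\<exists>\<nu>\<in>extremal_probs X \<alpha> m. a < \<phi> \<nu>"
proof (rule ccontr)
  assume neg: "\<not> ?thesis"
  have s: "sets \<alpha> = sets (borel_of X)" and pt: "polish_topology X"
    using pm by (auto simp: polish_measure_space_def)
  note hull = mix_hull_bounded_probs[OF s extremal_probs_subset[OF pt s]]
  have le: "\<phi> \<nu> \<le> a" if "\<nu> \<in> mix_hull (extremal_probs X \<alpha> m)" for \<nu>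
    using that
  proof induction
    case (base \<nu>)
    then show ?case using neg by force
  next
    case (mix \<nu> \<nu>' t)
    have "\<phi> (mixture t \<nu> \<nu>') \<le> (1 - t) * \<phi> \<nu> + t * \<phi> \<nu>'"
      using mix by (intro convex hull)
    also have "\<dots> \<le> (1 - t) * a + t * a" using mix by (intro add_mono mult_left_mono) auto
    finally show ?case by (simp add: algebra_simps)
  qed
  obtain W where W: "openin (weak_topology X) W" "{\<nu> \<in> bounded_probs X \<alpha> m. a < \<phi> \<nu>} = W \<inter> bounded_probs X \<alpha> m"
    using lsc by (auto simp: openin_subtopology)
  have "\<mu> \<in> W" using W(2) \<mu> a by blast
  from weak_topology_neighbourhood[OF W(1) this] obtain F \<epsilon> where F: "finite F"
    "\<forall>f\<in>F. continuous_map X euclideanreal f \<and> bounded (f ` topspace X)" "0 < \<epsilon>"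
    "{\<nu> \<in> borel_probs X. \<forall>f\<in>F. \<bar>(\<integral>x. f x \<partial>\<nu>) - (\<integral>x. f x \<partial>\<mu>)\<bar> < \<epsilon>} \<subseteq> W"
    by (elim exE conjE)
  have "\<exists>\<nu>\<in>mix_hull (extremal_probs X \<alpha> m). \<forall>f\<in>F. \<bar>(\<integral>x. f x \<partial>\<nu>) - (\<integral>x. f x \<partial>\<mu>)\<bar> < \<epsilon>"
    by (rule extremal_hull_weakly_dense[OF pm m \<mu> F(1) bspec[OF F(2)] F(3)])
  then obtain \<nu> where \<nu>: "\<nu> \<in> mix_hull (extremal_probs X \<alpha> m)"
    "\<forall>f\<in>F. \<bar>(\<integral>x. f x \<partial>\<nu>) - (\<integral>x. f x \<partial>\<mu>)\<bar> < \<epsilon>" by (elim bexE)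
  have \<nu>b: "\<nu> \<in> bounded_probs X \<alpha> m" using hull[OF \<nu>(1)] .
  then have "\<nu> \<in> borel_probs X" by (simp add: bounded_probs_def)
  then have "\<nu> \<in> W" using F(4) \<nu>(2) by blast
  then have "a < \<phi> \<nu>" using \<nu>b W(2) by blast
  then show False using le[OF \<nu>(1)] by simp
qed

theorem theorem1p5:
  fixes n :: nat
    and E :: "nat \<Rightarrow> 'a topology"
    and \<alpha> :: "nat \<Rightarrow> 'a measure"
    and m :: "nat \<Rightarrow> ennreal"
    and \<Phi> :: "(nat \<Rightarrow> 'a measure) \<Rightarrow> real"
  assumes "\<And>i. i \<in> {1..n} \<Longrightarrow> polish_measure_space (E i) (\<alpha> i)"
    and "\<And>i. i \<in> {1..n} \<Longrightarrow> 0 < m i"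
    and "coordinate_convex {1..n} (\<lambda>i. bounded_probs (E i) (\<alpha> i) (m i)) \<Phi>"
    and "lower_semicontinuous_map
           (product_topology
              (\<lambda>i. subtopology (weak_topology (E i)) (bounded_probs (E i) (\<alpha> i) (m i))) {1..n}) \<Phi>"
  shows "(SUP \<mu>\<in>(\<Pi>\<^sub>E i\<in>{1..n}. bounded_probs (E i) (\<alpha> i) (m i)). ereal (\<Phi> \<mu>)) =
         (SUP \<mu>\<in>(\<Pi>\<^sub>E i\<in>{1..n}. extremal_probs (E i) (\<alpha> i) (m i)). ereal (\<Phi> \<mu>))"
proof -
  define S where "S i = bounded_probs (E i) (\<alpha> i) (m i)" for i
  define T where "T i = extremal_probs (E i) (\<alpha> i) (m i)" for i
  define Y where "Y i = subtopology (weak_topology (E i)) (S i)" for i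
  have TS: "T i \<subseteq> S i" if "i \<in> {1..n}" for i
    using extremal_probs_subset assms(1)[OF that] by (auto simp: T_def S_def polish_measure_space_def)
  have Ytop: "topspace (Y i) = S i" for i
    by (auto simp: Y_def topspace_weak_topology S_def bounded_probs_def)
  have lsc: "openin (product_topology Y {1..n}) {\<mu> \<in> (\<Pi>\<^sub>E i\<in>{1..n}. S i). a < \<Phi> \<mu>}" for a
    using assms(4) unfolding lower_semicontinuous_map_def
    by (simp add: Y_def[abs_def, symmetric] S_def[symmetric] Ytop)
  \<comment> \<open>Inserting a measure into coordinate \<open>i\<close> is continuous, so the sections of \<open>\<Phi>\<close> are lower
    semicontinuous.\<close>
  have replace: "\<exists>\<nu>\<in>T i. a < \<Phi> (\<mu>(i := \<nu>))"
    if i: "i \<in> {1..n}" and \<mu>: "\<mu> \<in> (\<Pi>\<^sub>E i\<in>{1..n}. S i)" and a: "a < \<Phi> \<mu>" for i \<mu> a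
    unfolding T_def
  proof (rule convex_lsc_exceeds_on_extremal[where \<phi>="\<lambda>\<nu>. \<Phi> (\<mu>(i := \<nu>))" and \<mu>="\<mu> i"])
    show "polish_measure_space (E i) (\<alpha> i)" "0 < m i" using assms(1,2) i by auto
    show "\<mu> i \<in> bounded_probs (E i) (\<alpha> i) (m i)" using \<mu> i by (auto simp: S_def)
    show "a < \<Phi> (\<mu>(i := \<mu> i))" using a by simp
    show "\<Phi> (\<mu>(i := mixture t \<nu>\<^sub>0 \<nu>\<^sub>1)) \<le> (1 - t) * \<Phi> (\<mu>(i := \<nu>\<^sub>0)) + t * \<Phi> (\<mu>(i := \<nu>\<^sub>1))"
      if "\<nu>\<^sub>0 \<in> bounded_probs (E i) (\<alpha> i) (m i)" "\<nu>\<^sub>1 \<in> bounded_probs (E i) (\<alpha> i) (m i)" "t \<in> {0..1}" for \<nu>\<^sub>0 \<nu>\<^sub>1 t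
      using assms(3) \<mu> i that unfolding coordinate_convex_def S_def by blast
    have "continuous_map (Y i) (product_topology Y {1..n}) (\<lambda>\<nu>. \<mu>(i := \<nu>))"
      unfolding continuous_map_componentwise
    proof (intro conjI ballI)
      show "(\<lambda>\<nu>. \<mu>(i := \<nu>)) ` topspace (Y i) \<subseteq> extensional {1..n}"
        using \<mu> i by (auto simp: PiE_def extensional_def)
      fix k assume "k \<in> {1..n}"
      then show "continuous_map (Y i) (Y k) (\<lambda>\<nu>. (\<mu>(i := \<nu>)) k)"
        using \<mu> by (cases "k = i") (auto simp: Ytop PiE_iff)
    qed
    from openin_continuous_map_preimage[OF this lsc[of a]]
    have "openin (Y i) {\<nu> \<in> S i. \<mu>(i := \<nu>) \<in> (\<Pi>\<^sub>E i\<in>{1..n}. S i) \<and> a < \<Phi> (\<mu>(i := \<nu>))}"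
      by (simp add: Ytop)
    also have "{\<nu> \<in> S i. \<mu>(i := \<nu>) \<in> (\<Pi>\<^sub>E i\<in>{1..n}. S i) \<and> a < \<Phi> (\<mu>(i := \<nu>))}
        = {\<nu> \<in> S i. a < \<Phi> (\<mu>(i := \<nu>))}"
      using \<mu> i by (auto simp: PiE_iff extensional_def)
    finally show "openin (subtopology (weak_topology (E i)) (bounded_probs (E i) (\<alpha> i) (m i)))
        {\<nu> \<in> bounded_probs (E i) (\<alpha> i) (m i). a < \<Phi> (\<mu>(i := \<nu>))}"
      by (simp add: Y_def S_def)
  qed
  have all: "\<exists>\<nu>\<in>(\<Pi>\<^sub>E i\<in>{1..n}. T i). a < \<Phi> \<nu>" if \<mu>: "\<mu> \<in> (\<Pi>\<^sub>E i\<in>{1..n}. S i)" and a: "a < \<Phi> \<mu>" for \<mu> a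
  proof -
    have "\<exists>\<nu>\<in>(\<Pi>\<^sub>E i\<in>{1..n}. S i). (\<forall>j\<in>J. \<nu> j \<in> T j) \<and> a < \<Phi> \<nu>" if "finite J" "J \<subseteq> {1..n}" for J
      using that
    proof (induction J)
      case empty
      then show ?case using \<mu> a by auto
    next
      case (insert i J)
      then obtain \<nu> where \<nu>: "\<nu> \<in> (\<Pi>\<^sub>E i\<in>{1..n}. S i)" "\<forall>j\<in>J. \<nu> j \<in> T j" "a < \<Phi> \<nu>" by auto
      have i: "i \<in> {1..n}" using insert by auto
      obtain \<rho> where \<rho>: "\<rho> \<in> T i" "a < \<Phi> (\<nu>(i := \<rho>))" using replace[OF i \<nu>(1,3)] by blast
      have "\<rho> \<in> S i" using \<rho>(1) TS[OF i] by blast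
      then have "\<nu>(i := \<rho>) \<in> (\<Pi>\<^sub>E i\<in>{1..n}. S i)"
        using \<nu>(1) i by (auto simp: PiE_iff extensional_def)
      moreover have "\<forall>j\<in>insert i J. (\<nu>(i := \<rho>)) j \<in> T j" using \<nu>(2) \<rho>(1) by auto
      ultimately show ?case using \<rho>(2) by blast
    qed
    from this[of "{1..n}"] show ?thesis by (auto simp: PiE_iff)
  qed
  have "(SUP \<mu>\<in>(\<Pi>\<^sub>E i\<in>{1..n}. S i). ereal (\<Phi> \<mu>)) = (SUP \<mu>\<in>(\<Pi>\<^sub>E i\<in>{1..n}. T i). ereal (\<Phi> \<mu>))"
  proof (rule antisym)
    show "(SUP \<mu>\<in>(\<Pi>\<^sub>E i\<in>{1..n}. S i). ereal (\<Phi> \<mu>)) \<le> (SUP \<mu>\<in>(\<Pi>\<^sub>E i\<in>{1..n}. T i). ereal (\<Phi> \<mu>))"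
    proof (rule SUP_least, rule ccontr)
      fix \<mu> assume \<mu>: "\<mu> \<in> (\<Pi>\<^sub>E i\<in>{1..n}. S i)"
        and "\<not> ereal (\<Phi> \<mu>) \<le> (SUP \<mu>\<in>(\<Pi>\<^sub>E i\<in>{1..n}. T i). ereal (\<Phi> \<mu>))"
      then obtain a where a: "(SUP \<mu>\<in>(\<Pi>\<^sub>E i\<in>{1..n}. T i). ereal (\<Phi> \<mu>)) < ereal a" "a < \<Phi> \<mu>"
        using ereal_dense2 by (metis less_ereal.simps(1) not_le)
      then obtain \<nu> where \<nu>: "\<nu> \<in> (\<Pi>\<^sub>E i\<in>{1..n}. T i)" "a < \<Phi> \<nu>" using all[OF \<mu>] by blast
      then have "ereal (\<Phi> \<nu>) \<le> (SUP \<mu>\<in>(\<Pi>\<^sub>E i\<in>{1..n}. T i). ereal (\<Phi> \<mu>))" by (intro SUP_upper)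
      also note a(1)
      finally show False using \<nu>(2) by simp
    qed
    show "(SUP \<mu>\<in>(\<Pi>\<^sub>E i\<in>{1..n}. T i). ereal (\<Phi> \<mu>)) \<le> (SUP \<mu>\<in>(\<Pi>\<^sub>E i\<in>{1..n}. S i). ereal (\<Phi> \<mu>))"
      using TS by (intro SUP_subset_mono PiE_mono) auto
  qed
  then show ?thesis unfolding S_def T_def .
qed

end
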